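(* Let $G$ be a locally compact, compactly generated group having a 1-cocycle of linear growth (e.g. $G=\mathbf{Z}^n$ or $\mathbf{R}^n$ for $n\ge1$). Then, for every function $f:G\to\mathbf{R}_+$ with sublinear growth, there exists on $G$ a sublinear 1-cocycle $b$ such that $\|b(g)\|\succeq f(g)$.
   Context: A 1-cocycle of $G$ is a continuous map $b:G\to\mathcal{H}$ to a Hilbert space carrying a continuous unitary or orthogonal representation $\pi$ of $G$, with $b(gh)=\pi(g)b(h)+b(g)$ for all $g,h\in G$. For $f,h:G\to\mathbf{R}_+$: $f\preceq h$ (equivalently $h\succeq f$) means that there are $M>0$ and a compact $K\subset G$ with $f\le Mh$ outside $K$; $f\prec h$ means that for every $\varepsilon>0$ there is a compact $K\subset G$ with $f\le\varepsilon h$ outside $K$. Let $|\cdot|_S$ be the word length with respect to a relatively compact generating subset $S$ of $G$. A 1-cocycle $b$ has linear growth if $\|b(g)\|\succeq|g|_S$; a function $f$ has sublinear growth if $f(g)\prec|g|_S$; a 1-cocycle $b$ is sublinear if $\|b(g)\|\prec|g|_S$. *)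

theory Defs
  imports "HOL-Analysis.Analysis" "HOL-Algebra.Module" "HOL-Algebra.Algebraic_Closure_Type"
begin

text \<open>
  A topological group is a type of class \<open>topological_group_add\<close>. That class is not
  commutative; the group law is merely written \<open>+\<close>, the unit \<open>0\<close>, the inverse \<open>- g\<close>.
\<close>

subsection \<open>Word length and comparison of growth\<close>

definition word_over :: "'g::group_add set \<Rightarrow> 'g list \<Rightarrow> bool" where
  "word_over S xs \<longleftrightarrow> set xs \<subseteq> S \<union> uminus ` S"

definition generates_group :: "'g::group_add set \<Rightarrow> bool" where
  "generates_group S \<longleftrightarrow> (\<forall>g. \<exists>xs. word_over S xs \<and> sum_list xs = g)"

text \<open>Only meaningful when \<open>S\<close> generates the group.\<close>
definition word_length :: "'g::group_add set \<Rightarrow> 'g \<Rightarrow> nat" where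
  "word_length S g = (LEAST n. \<exists>xs. word_over S xs \<and> length xs = n \<and> sum_list xs = g)"

definition growth_le :: "('g::topological_space \<Rightarrow> real) \<Rightarrow> ('g \<Rightarrow> real) \<Rightarrow> bool" where
  "growth_le f h \<longleftrightarrow> (\<exists>M>0. \<exists>K. compact K \<and> (\<forall>g. g \<notin> K \<longrightarrow> f g \<le> M * h g))"

definition growth_less :: "('g::topological_space \<Rightarrow> real) \<Rightarrow> ('g \<Rightarrow> real) \<Rightarrow> bool" where
  "growth_less f h \<longleftrightarrow> (\<forall>\<epsilon>>0. \<exists>K. compact K \<and> (\<forall>g. g \<notin> K \<longrightarrow> f g \<le> \<epsilon> * h g))"

definition sublinear_growth :: "'g::{topological_space, group_add} set \<Rightarrow> ('g \<Rightarrow> real) \<Rightarrow> bool" where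
  "sublinear_growth S f \<longleftrightarrow> growth_less f (\<lambda>g. real (word_length S g))"

subsection \<open>Hilbert spaces with an explicit carrier\<close>

text \<open>
  The existence of a cocycle includes the existence of its Hilbert space. As types cannot be
  quantified, a Hilbert space is a structure on a carrier set. For a group of type \<open>'g\<close> the
  carrier may be taken inside \<open>'g \<Rightarrow> real\<close> (resp. \<open>'g \<Rightarrow> complex\<close>) without loss of generality:
  the closed span of the values of a cocycle is invariant under the representation and has
  Hilbert dimension at most the cardinality of \<open>'g\<close>, so it is isometric to a subspace of the
  square-summable functions on \<open>'g\<close>. The multiplicative fields
  \<open>mult\<close> and \<open>one\<close> inherited from the record \<open>module\<close> play no role.
\<close>

record ('k, 'v) inner_module = "('k, 'v) module" +
  ip :: "'v \<Rightarrow> 'v \<Rightarrow> 'k"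

definition vnorm :: "('k::real_normed_field, 'v) inner_module \<Rightarrow> 'v \<Rightarrow> real" where
  "vnorm H v = sqrt (norm (ip H v v))"

text \<open>The value \<open>0\<close> off the carrier makes the symmetry axiom of \<open>Metric_space\<close>,
  which is not relativised to the carrier, hold.\<close>
definition vdist :: "('k::real_normed_field, 'v) inner_module \<Rightarrow> 'v \<Rightarrow> 'v \<Rightarrow> real" where
  "vdist H u v =
     (if u \<in> carrier H \<and> v \<in> carrier H then vnorm H (u \<ominus>\<^bsub>H\<^esub> v) else 0)"

abbreviation vtopology :: "('k::real_normed_field, 'v) inner_module \<Rightarrow> 'v topology" where
  "vtopology H \<equiv> Metric_space.mtopology (carrier H) (vdist H)"

text \<open>
  The parameter \<open>cj\<close> is the conjugation of the scalar field: the identity on \<open>real\<close>,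
  \<open>cnj\<close> on \<open>complex\<close>. The inner product is linear in its first argument. The module locale
  is the one over a HOL-Algebra ring, not the type-class based one of the same name.
\<close>
definition hilbert_space ::
  "('k::real_normed_field \<Rightarrow> 'k) \<Rightarrow> ('k, 'v) inner_module \<Rightarrow> bool" where
  "hilbert_space cj H \<longleftrightarrow>
     Module.module (ring_of_type_algebra :: 'k ring) H \<and>
     (\<forall>x\<in>carrier H. \<forall>y\<in>carrier H. \<forall>z\<in>carrier H.
        ip H (x \<oplus>\<^bsub>H\<^esub> y) z = ip H x z + ip H y z) \<and>
     (\<forall>a. \<forall>x\<in>carrier H. \<forall>y\<in>carrier H. ip H (a \<odot>\<^bsub>H\<^esub> x) y = a * ip H x y) \<and>
     (\<forall>x\<in>carrier H. \<forall>y\<in>carrier H. ip H y x = cj (ip H x y)) \<and>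
     (\<forall>x\<in>carrier H. \<exists>r::real. r \<ge> 0 \<and> ip H x x = of_real r) \<and>
     (\<forall>x\<in>carrier H. ip H x x = 0 \<longrightarrow> x = \<zero>\<^bsub>H\<^esub>) \<and>
     Metric_space.mcomplete (carrier H) (vdist H)"

subsection \<open>Representations and cocycles\<close>

text \<open>
  A representation by linear isometries; these are bijective because \<open>\<pi> (- g)\<close> is inverse to
  \<open>\<pi> g\<close>. Continuity is continuity of the orbit maps (strong continuity).
\<close>
definition isometric_rep ::
  "('k::real_normed_field, 'v) inner_module \<Rightarrow> ('g::topological_group_add \<Rightarrow> 'v \<Rightarrow> 'v) \<Rightarrow> bool" where
  "isometric_rep H \<pi> \<longleftrightarrow>
     (\<forall>g. \<forall>x\<in>carrier H. \<pi> g x \<in> carrier H) \<and>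
     (\<forall>g. \<forall>x\<in>carrier H. \<forall>y\<in>carrier H. \<pi> g (x \<oplus>\<^bsub>H\<^esub> y) = \<pi> g x \<oplus>\<^bsub>H\<^esub> \<pi> g y) \<and>
     (\<forall>g a. \<forall>x\<in>carrier H. \<pi> g (a \<odot>\<^bsub>H\<^esub> x) = a \<odot>\<^bsub>H\<^esub> \<pi> g x) \<and>
     (\<forall>g. \<forall>x\<in>carrier H. \<forall>y\<in>carrier H. ip H (\<pi> g x) (\<pi> g y) = ip H x y) \<and>
     (\<forall>x\<in>carrier H. \<pi> 0 x = x) \<and>
     (\<forall>g h. \<forall>x\<in>carrier H. \<pi> (g + h) x = \<pi> g (\<pi> h x)) \<and>
     (\<forall>x\<in>carrier H. continuous_map euclidean (vtopology H) (\<lambda>g. \<pi> g x))"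

definition one_cocycle ::
  "('k::real_normed_field, 'v) inner_module \<Rightarrow> ('g::topological_group_add \<Rightarrow> 'v \<Rightarrow> 'v) \<Rightarrow>
   ('g \<Rightarrow> 'v) \<Rightarrow> bool" where
  "one_cocycle H \<pi> b \<longleftrightarrow>
     isometric_rep H \<pi> \<and>
     continuous_map euclidean (vtopology H) b \<and>
     (\<forall>g h. b (g + h) = \<pi> g (b h) \<oplus>\<^bsub>H\<^esub> b g)"

definition orthogonal_cocycle ::
  "(real, 'v) inner_module \<Rightarrow> ('g::topological_group_add \<Rightarrow> 'v \<Rightarrow> 'v) \<Rightarrow> ('g \<Rightarrow> 'v) \<Rightarrow> bool" where
  "orthogonal_cocycle H \<pi> b \<longleftrightarrow> hilbert_space id H \<and> one_cocycle H \<pi> b"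

definition unitary_cocycle ::
  "(complex, 'v) inner_module \<Rightarrow> ('g::topological_group_add \<Rightarrow> 'v \<Rightarrow> 'v) \<Rightarrow> ('g \<Rightarrow> 'v) \<Rightarrow> bool" where
  "unitary_cocycle H \<pi> b \<longleftrightarrow> hilbert_space cnj H \<and> one_cocycle H \<pi> b"

definition linear_cocycle_growth ::
  "'g::topological_group_add set \<Rightarrow> ('k::real_normed_field, 'v) inner_module \<Rightarrow> ('g \<Rightarrow> 'v) \<Rightarrow> bool" where
  "linear_cocycle_growth S H b \<longleftrightarrow>
     growth_le (\<lambda>g. real (word_length S g)) (\<lambda>g. vnorm H (b g))"

definition sublinear_cocycle ::
  "'g::topological_group_add set \<Rightarrow> ('k::real_normed_field, 'v) inner_module \<Rightarrow> ('g \<Rightarrow> 'v) \<Rightarrow> bool" where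
  "sublinear_cocycle S H b \<longleftrightarrow> sublinear_growth S (\<lambda>g. vnorm H (b g))"

end

theory Submission
  imports Defs
begin

text \<open>
  Let \<open>b\<close> be a cocycle of linear growth and \<open>\<psi> g\<close> the square of the norm of \<open>b g\<close>. Let \<open>F\<close> be a
  mixture, with nonnegative weights, of the functions \<open>s \<mapsto> 1 - exp (- s / t)\<close> for \<open>t > 0\<close>; this is a
  Bernstein function. By Schoenberg, \<open>F \<circ> \<psi>\<close> is again the squared norm of a cocycle. As \<open>\<psi>\<close> is
  comparable to the squared word length off a compact set, it remains to choose \<open>F\<close> with \<open>F s / s\<close>
  tending to zero at infinity, but so slowly that \<open>F \<circ> \<psi>\<close> dominates \<open>f\<^sup>2\<close>.

  The choice is \<open>F s = (\<Sum>n. (1 / 2) ^ n * T n * (1 - exp (- s / T n)))\<close>. This is sublinear for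
  every choice of scales \<open>T n\<close>, since each term is bounded and the slopes are summable
  (\<open>bernstein_sublinear\<close>). For \<open>s \<le> T n\<close> it is at least a constant times \<open>(1 / 2) ^ n * s\<close>. Since \<open>f\<close>
  has sublinear growth, \<open>T n\<close> can be taken so large that \<open>f\<^sup>2\<close> is at most a constant times
  \<open>(1 / 4) ^ n * \<psi>\<close> where \<open>\<psi>\<close> exceeds \<open>T n\<close>, off a compact set independent of \<open>n\<close> (\<open>scales_for_sublinear\<close>), and comparing the two estimates
  shows that \<open>F \<circ> \<psi>\<close> dominates \<open>f\<^sup>2\<close> (\<open>le_bernstein\<close>).

  The step from \<open>\<psi>\<close> to \<open>F \<circ> \<psi>\<close> is made on kernels. The kernel
  \<open>K g h = (\<psi> g + \<psi> h - \<psi> (- g + h)) / 2\<close> is the real inner product of \<open>b g\<close> and \<open>b h\<close>, hence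
  positive. The corresponding kernel of \<open>1 - exp (- \<psi> / t)\<close> is obtained from \<open>K\<close> by weights, sums and
  powers, and is therefore positive by the Schur product theorem (\<open>psd_kernel_mult\<close>,
  \<open>psd_kernel_one_minus_exp\<close>). Conversely, a positive kernel of this form, continuous on the diagonal,
  comes from a cocycle: its reproducing kernel Hilbert space consists of real functions on the group,
  the group acts on it by translating functions and subtracting a constant so that they
  vanish at the unit, and the kernel functions are the values of the cocycle
  (\<open>orthogonal_cocycle_rkhs\<close>).
\<close>

section \<open>Positive kernels\<close>

text \<open>A finite real combination of points is a list of coefficients and points. Points may repeat, so
  adding combinations is appending lists, and a translated combination needs no normalisation.\<close>

definition comb_sum :: "(real \<times> 'a) list \<Rightarrow> ('a \<Rightarrow> real) \<Rightarrow> real" where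
  "comb_sum l \<phi> = (\<Sum>(c, x)\<leftarrow>l. c * \<phi> x)"

definition gram :: "('a \<Rightarrow> 'a \<Rightarrow> real) \<Rightarrow> (real \<times> 'a) list \<Rightarrow> (real \<times> 'a) list \<Rightarrow> real" where
  "gram K l m = comb_sum l (\<lambda>x. comb_sum m (K x))"

definition scale_comb :: "real \<Rightarrow> (real \<times> 'a) list \<Rightarrow> (real \<times> 'a) list" where
  "scale_comb s l = map (\<lambda>(c, x). (s * c, x)) l"

definition psd_kernel :: "('a \<Rightarrow> 'a \<Rightarrow> real) \<Rightarrow> bool" where
  "psd_kernel K \<longleftrightarrow> (\<forall>x y. K x y = K y x) \<and> (\<forall>l. 0 \<le> gram K l l)"

lemma comb_sum_Nil [simp]: "comb_sum [] \<phi> = 0"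
  and comb_sum_Cons [simp]: "comb_sum ((c, x) # l) \<phi> = c * \<phi> x + comb_sum l \<phi>"
  and comb_sum_append [simp]: "comb_sum (l @ m) \<phi> = comb_sum l \<phi> + comb_sum m \<phi>"
  by (simp_all add: comb_sum_def)

lemma comb_sum_scale [simp]: "comb_sum (scale_comb s l) \<phi> = s * comb_sum l \<phi>"
  by (induction l) (auto simp: scale_comb_def algebra_simps)

lemma comb_sum_zero [simp]: "comb_sum l (\<lambda>x. 0) = 0"
  by (induction l) auto

lemma comb_sum_add: "comb_sum l (\<lambda>x. \<phi> x + \<psi> x) = comb_sum l \<phi> + comb_sum l \<psi>"
  by (induction l) (auto simp: algebra_simps)

lemma comb_sum_diff: "comb_sum l (\<lambda>x. \<phi> x - \<psi> x) = comb_sum l \<phi> - comb_sum l \<psi>"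
  by (induction l) (auto simp: algebra_simps)

lemma comb_sum_mult: "comb_sum l (\<lambda>x. s * \<phi> x) = s * comb_sum l \<phi>"
  by (induction l) (auto simp: algebra_simps)

lemma comb_sum_mult_right: "comb_sum l (\<lambda>x. \<phi> x * s) = comb_sum l \<phi> * s"
  by (induction l) (auto simp: algebra_simps)

lemma comb_sum_cong: "(\<And>x. x \<in> snd ` set l \<Longrightarrow> \<phi> x = \<psi> x) \<Longrightarrow> comb_sum l \<phi> = comb_sum l \<psi>"
  by (induction l) auto

lemma comb_sum_weight:
  "comb_sum (map (\<lambda>(c, x). (c * w x, x)) l) \<phi> = comb_sum l (\<lambda>x. w x * \<phi> x)"
  by (induction l) auto

lemma comb_sum_swap:
  "comb_sum l (\<lambda>x. comb_sum m (\<lambda>y. K x y)) = comb_sum m (\<lambda>y. comb_sum l (\<lambda>x. K x y))"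
  by (induction l) (auto simp: comb_sum_add comb_sum_mult)

lemma tendsto_comb_sum:
  "(\<And>x. ((\<lambda>n. \<phi> n x) \<longlongrightarrow> \<psi> x) F) \<Longrightarrow> ((\<lambda>n. comb_sum l (\<phi> n)) \<longlongrightarrow> comb_sum l \<psi>) F"
proof (induction l)
  case (Cons a l)
  obtain c x where "a = (c, x)" by fastforce
  then show ?case
    using tendsto_add[OF tendsto_mult_left[OF Cons.prems] Cons.IH[OF Cons.prems]] by simp
qed simp

lemma gram_append_left [simp]: "gram K (l @ l') m = gram K l m + gram K l' m"
  and gram_append_right [simp]: "gram K l (m @ m') = gram K l m + gram K l m'"
  and gram_scale_left [simp]: "gram K (scale_comb s l) m = s * gram K l m"
  and gram_scale_right [simp]: "gram K l (scale_comb s m) = s * gram K l m"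
  by (simp_all add: gram_def comb_sum_add comb_sum_mult)

lemma gram_commute: "psd_kernel K \<Longrightarrow> gram K l m = gram K m l"
  unfolding gram_def psd_kernel_def by (subst comb_sum_swap) simp

lemma gram_nonneg: "psd_kernel K \<Longrightarrow> 0 \<le> gram K l l"
  by (simp add: psd_kernel_def)

text \<open>Applied to the squared norm of \<open>u + t * v\<close> as a polynomial in \<open>t\<close>, this gives the
  Cauchy--Schwarz inequalities below.\<close>

lemma discriminant_nonpos:
  fixes A B C :: real
  assumes "0 \<le> C" and nonneg: "\<And>t. 0 \<le> A + 2 * t * B + t\<^sup>2 * C"
  shows "B\<^sup>2 \<le> A * C"
proof (cases "C = 0")
  case True
  have "B = 0"
  proof (rule ccontr)
    assume "B \<noteq> 0"
    then show False
      using nonneg[of "- (A + 1) / (2 * B)"] True by (simp add: field_simps)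
  qed
  then show ?thesis using True by simp
next
  case False
  with assms(1) have C: "C > 0" by simp
  have "0 \<le> A + 2 * (- B / C) * B + (- B / C)\<^sup>2 * C" by (rule nonneg)
  also have "\<dots> = A - B\<^sup>2 / C" using C by (simp add: field_simps power2_eq_square)
  finally show ?thesis using C by (simp add: field_simps)
qed

lemma gram_Cauchy_Schwarz:
  assumes "psd_kernel K"
  shows "(gram K l m)\<^sup>2 \<le> gram K l l * gram K m m"
proof (rule discriminant_nonpos)
  show "0 \<le> gram K m m" by (rule gram_nonneg[OF assms])
  fix t
  have "0 \<le> gram K (l @ scale_comb t m) (l @ scale_comb t m)"
    by (rule gram_nonneg[OF assms])
  then show "0 \<le> gram K l l + 2 * t * gram K l m + t\<^sup>2 * gram K m m"
    using gram_commute[OF assms, of m l] by (simp add: algebra_simps power2_eq_square)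
qed

lemma abs_gram_le:
  assumes "psd_kernel K"
  shows "\<bar>gram K l m\<bar> \<le> sqrt (gram K l l) * sqrt (gram K m m)"
  using real_sqrt_le_mono[OF gram_Cauchy_Schwarz[OF assms, of l m]]
  by (simp add: real_sqrt_mult)

lemma gram_singleton [simp]: "gram K [(1, x)] [(1, y)] = K x y"
  by (simp add: gram_def)

subsection \<open>Operations on positive kernels\<close>

lemma psd_kernel_zero: "psd_kernel (\<lambda>x y. 0)"
  by (simp add: psd_kernel_def gram_def)

lemma psd_kernel_add:
  assumes "psd_kernel K" "psd_kernel L"
  shows "psd_kernel (\<lambda>x y. K x y + L x y)"
  using assms unfolding psd_kernel_def gram_def comb_sum_add by simp

lemma psd_kernel_scale:
  assumes "psd_kernel K" "0 \<le> s"
  shows "psd_kernel (\<lambda>x y. s * K x y)"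
  using assms unfolding psd_kernel_def gram_def comb_sum_mult by simp

lemma psd_kernel_weight:
  assumes "psd_kernel K"
  shows "psd_kernel (\<lambda>x y. w x * w y * K x y)"
proof -
  have "gram (\<lambda>x y. w x * w y * K x y) l l
      = gram K (map (\<lambda>(c, x). (c * w x, x)) l) (map (\<lambda>(c, x). (c * w x, x)) l)" for l
    by (simp add: gram_def comb_sum_weight comb_sum_mult mult.assoc)
  then show ?thesis
    using assms by (auto simp: psd_kernel_def)
qed

lemma psd_kernel_square: "psd_kernel (\<lambda>x y. w x * w y)"
  by (simp add: psd_kernel_def gram_def comb_sum_mult comb_sum_mult_right)

lemma psd_kernel_sum:
  assumes "\<And>i. i \<in> I \<Longrightarrow> psd_kernel (K i)"
  shows "psd_kernel (\<lambda>x y. \<Sum>i\<in>I. K i x y)"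
  using assms
  by (induction I rule: infinite_finite_induct) (auto intro: psd_kernel_add psd_kernel_zero)

text \<open>Positivity is tested on finitely many points at a time, so pointwise limits keep it.\<close>

lemma psd_kernel_limit:
  assumes "\<And>n. psd_kernel (K n)" and lim: "\<And>x y. (\<lambda>n. K n x y) \<longlonglongrightarrow> L x y"
  shows "psd_kernel L"
  unfolding psd_kernel_def
proof (intro conjI allI)
  fix x y
  have "(\<lambda>n. K n x y) \<longlonglongrightarrow> L y x"
    using lim[of y x] assms(1) by (simp add: psd_kernel_def)
  then show "L x y = L y x" using lim LIMSEQ_unique by blast
next
  fix l
  have "(\<lambda>n. gram (K n) l l) \<longlonglongrightarrow> gram L l l"
    unfolding gram_def by (intro tendsto_comb_sum lim)
  then show "0 \<le> gram L l l"
    using assms(1) by (intro LIMSEQ_le_const) (auto intro: gram_nonneg)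
qed

text \<open>Subtracting the rank-one kernel that agrees with a positive kernel in row \<open>a\<close> leaves a
  positive kernel (Cauchy--Schwarz), and this kernel is zero in row \<open>a\<close>. If \<open>K a a = 0\<close>, that
  row of \<open>K\<close> is already zero; division by zero makes the formula correct in this case too.\<close>

lemma psd_kernel_eliminate:
  assumes K: "psd_kernel K"
  shows "psd_kernel (\<lambda>x y. K x y - K x a * K y a / K a a)"
    and "K a y - K a a * K y a / K a a = 0"
proof -
  have sym: "K x y = K y x" for x y using K by (simp add: psd_kernel_def)
  have pos: "0 \<le> K a a" using gram_nonneg[OF K, of "[(1, a)]"] by simp
  show "psd_kernel (\<lambda>x y. K x y - K x a * K y a / K a a)"
    unfolding psd_kernel_def
  proof (intro conjI allI)
    fix l
    have "gram K l [(1, a)] = comb_sum l (\<lambda>x. K x a)" by (simp add: gram_def)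
    then have CS: "(comb_sum l (\<lambda>x. K x a))\<^sup>2 \<le> gram K l l * K a a"
      using gram_Cauchy_Schwarz[OF K, of l "[(1, a)]"] by simp
    have "comb_sum l (\<lambda>y. K x a * K y a / K a a) = K x a * (comb_sum l (\<lambda>y. K y a) / K a a)" for x
      using comb_sum_mult[of l "K x a / K a a" "\<lambda>y. K y a"] by (simp add: mult.commute)
    then have "gram (\<lambda>x y. K x y - K x a * K y a / K a a) l l
        = gram K l l - (comb_sum l (\<lambda>x. K x a))\<^sup>2 / K a a"
      using comb_sum_mult_right[of l "\<lambda>x. K x a" "comb_sum l (\<lambda>y. K y a) / K a a"]
      by (simp add: gram_def comb_sum_diff power2_eq_square)
    also have "\<dots> \<ge> 0"
      using CS pos gram_nonneg[OF K, of l] by (cases "K a a = 0") (auto simp: field_simps)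
    finally show "0 \<le> gram (\<lambda>x y. K x y - K x a * K y a / K a a) l l" .
  qed (use sym in auto)
  have "(K a y)\<^sup>2 \<le> K a a * K y y"
    using gram_Cauchy_Schwarz[OF K, of "[(1, a)]" "[(1, y)]"] by simp
  then show "K a y - K a a * K y a / K a a = 0"
    using sym[of a y] by (cases "K a a = 0") auto
qed

text \<open>The Schur product theorem. On the finitely many points of a combination, the elimination
  step writes \<open>K\<close> as a sum of rank-one kernels \<open>w x * w y\<close>; for such a factor the product with
  \<open>L\<close> only changes the coefficients of the combination by the weight \<open>w\<close>.\<close>

lemma psd_kernel_mult:
  assumes K: "psd_kernel K" and L: "psd_kernel L"
  shows "psd_kernel (\<lambda>x y. K x y * L x y)"
proof -
  have "0 \<le> gram (\<lambda>x y. K x y * L x y) l l" for l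
  proof -
    have "0 \<le> gram (\<lambda>x y. K x y * L x y) l l"
      if "finite B" "psd_kernel K" "\<And>x y. x \<in> snd ` set l - B \<Longrightarrow> K x y = 0" for B K
      using that
    proof (induction B arbitrary: K)
      case empty
      then have "comb_sum l (\<lambda>y. K x y * L x y) = 0" if "x \<in> snd ` set l" for x
        using that by simp
      then have "gram (\<lambda>x y. K x y * L x y) l l = comb_sum l (\<lambda>x. 0)"
        unfolding gram_def by (rule comb_sum_cong)
      then show ?case by simp
    next
      case (insert a B)
      define R where "R = (\<lambda>x y. K x y - K x a * K y a / K a a)"
      have R: "psd_kernel R"
        unfolding R_def by (rule psd_kernel_eliminate(1)[OF insert.prems(1)])
      have Ra: "R a y = 0" for y
        unfolding R_def by (rule psd_kernel_eliminate(2)[OF insert.prems(1)])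
      have "0 \<le> gram (\<lambda>x y. R x y * L x y) l l"
      proof (rule insert.IH[OF R])
        fix x y assume "x \<in> snd ` set l - B"
        then show "R x y = 0"
          using insert.prems(2)[of x] by (cases "x = a") (simp_all add: Ra, simp add: R_def)
      qed
      moreover have "0 \<le> gram (\<lambda>x y. K x a * K y a * (L x y / K a a)) l l"
      proof (rule gram_nonneg[OF psd_kernel_weight])
        show "psd_kernel (\<lambda>x y. L x y / K a a)"
          using psd_kernel_scale[OF L, of "1 / K a a"]
            gram_nonneg[OF insert.prems(1), of "[(1, a)]"] by simp
      qed
      moreover have "gram (\<lambda>x y. K x y * L x y) l l
          = gram (\<lambda>x y. R x y * L x y + K x a * K y a * (L x y / K a a)) l l"
        by (simp add: R_def algebra_simps)
      ultimately show ?case by (simp add: gram_def comb_sum_add)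
    qed
    \<comment> \<open>Start with all points of the combination still to be eliminated.\<close>
    from this[of "snd ` set l" K] K show ?thesis by simp
  qed
  then show ?thesis using K L by (auto simp: psd_kernel_def)
qed

lemma psd_kernel_power:
  assumes "psd_kernel K"
  shows "psd_kernel (\<lambda>x y. K x y ^ n)"
proof (induction n)
  case 0
  show ?case using psd_kernel_square[of "\<lambda>_. 1"] by simp
qed (use assms in \<open>simp add: psd_kernel_mult\<close>)

text \<open>The power series of the exponential without its constant term has nonnegative coefficients.\<close>

lemma psd_kernel_exp_minus_1:
  assumes "psd_kernel K"
  shows "psd_kernel (\<lambda>x y. exp (K x y) - 1)"
proof (rule psd_kernel_limit)
  fix n
  show "psd_kernel (\<lambda>x y. \<Sum>k<n. (1 / fact (Suc k)) * K x y ^ Suc k)"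
    by (intro psd_kernel_sum psd_kernel_scale psd_kernel_power assms) simp
next
  fix x y
  have "(\<lambda>k. K x y ^ k /\<^sub>R fact k) sums exp (K x y)" by (rule exp_converges)
  then have "(\<lambda>k. K x y ^ Suc k /\<^sub>R fact (Suc k)) sums (exp (K x y) - 1)"
    by (subst sums_Suc_iff) simp
  then show "(\<lambda>n. \<Sum>k<n. (1 / fact (Suc k)) * K x y ^ Suc k) \<longlonglongrightarrow> exp (K x y) - 1"
    by (simp add: sums_def divide_inverse)
qed

section \<open>Inner product spaces on a carrier\<close>

text \<open>The locale treats real and complex spaces at once: \<open>re\<close> is the real part of a scalar, and
  \<open>re \<circ> ip H\<close> is a real inner product. Completeness is left out because the metric
  has to be available before completeness of a newly built space can be discussed.\<close>

locale inner_product_space =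
  fixes cj :: "'k::real_normed_field \<Rightarrow> 'k" and re :: "'k \<Rightarrow> real"
    and H :: "('k, 'v) inner_module" (structure)
  assumes mod: "Module.module (ring_of_type_algebra :: 'k ring) H"
    and ip_add: "\<lbrakk>x \<in> carrier H; y \<in> carrier H; z \<in> carrier H\<rbrakk>
      \<Longrightarrow> ip H (x \<oplus> y) z = ip H x z + ip H y z"
    and ip_smult: "\<lbrakk>x \<in> carrier H; y \<in> carrier H\<rbrakk> \<Longrightarrow> ip H (a \<odot>\<^bsub>H\<^esub> x) y = a * ip H x y"
    and ip_sym: "\<lbrakk>x \<in> carrier H; y \<in> carrier H\<rbrakk> \<Longrightarrow> ip H y x = cj (ip H x y)"
    and ip_nonneg: "x \<in> carrier H \<Longrightarrow> \<exists>r::real. r \<ge> 0 \<and> ip H x x = of_real r"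
    and ip_definite: "\<lbrakk>x \<in> carrier H; ip H x x = 0\<rbrakk> \<Longrightarrow> x = \<zero>"
    and re_add: "re (a + b) = re a + re b"
    and re_mult: "re (of_real r * a) = r * re a"
    and re_one: "re 1 = 1"
    and re_cj: "re (cj a) = re a"
begin

abbreviation rip :: "'v \<Rightarrow> 'v \<Rightarrow> real" where
  "rip u v \<equiv> re (ip H u v)"

lemma abelian: "abelian_group H"
  using mod by (simp add: Module.module_def)

interpretation abelian_group H by (rule abelian)

lemma smult_carrier: "x \<in> carrier H \<Longrightarrow> a \<odot>\<^bsub>H\<^esub> x \<in> carrier H"
  using Module.module.smult_closed[OF mod, of a x] by (simp add: ring_of_type_algebra_def)

lemma re_of_real: "re (of_real r) = r"
  using re_mult[of r 1] re_one by simp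

lemma rip_add_left: "\<lbrakk>x \<in> carrier H; y \<in> carrier H; z \<in> carrier H\<rbrakk>
    \<Longrightarrow> rip (x \<oplus> y) z = rip x z + rip y z"
  by (simp add: ip_add re_add)

lemma rip_commute: "\<lbrakk>x \<in> carrier H; y \<in> carrier H\<rbrakk> \<Longrightarrow> rip x y = rip y x"
  using ip_sym[of x y] re_cj by simp

lemma rip_add_right: "\<lbrakk>x \<in> carrier H; y \<in> carrier H; z \<in> carrier H\<rbrakk>
    \<Longrightarrow> rip z (x \<oplus> y) = rip z x + rip z y"
  using rip_commute[of z "x \<oplus> y"] rip_commute[of z x] rip_commute[of z y] rip_add_left[of x y z]
  by simp

lemma rip_smult_left: "\<lbrakk>x \<in> carrier H; y \<in> carrier H\<rbrakk>
    \<Longrightarrow> rip (of_real r \<odot>\<^bsub>H\<^esub> x) y = r * rip x y"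
  by (simp add: ip_smult re_mult)

lemma rip_smult_right: "\<lbrakk>x \<in> carrier H; y \<in> carrier H\<rbrakk>
    \<Longrightarrow> rip y (of_real r \<odot>\<^bsub>H\<^esub> x) = r * rip y x"
  using rip_commute[of y "of_real r \<odot>\<^bsub>H\<^esub> x"] rip_commute[of y x] rip_smult_left[of x y r]
  by (simp add: smult_carrier)

lemma rip_zero_left: "y \<in> carrier H \<Longrightarrow> rip \<zero> y = 0"
  using rip_add_left[of "\<zero>" "\<zero>" y] by simp

lemma rip_nonneg: "x \<in> carrier H \<Longrightarrow> 0 \<le> rip x x"
  using ip_nonneg[of x] re_of_real by auto

lemma vnorm_eq: "x \<in> carrier H \<Longrightarrow> vnorm H x = sqrt (rip x x)"
  using ip_nonneg[of x] re_of_real by (auto simp: vnorm_def)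

lemma vnorm_squared: "x \<in> carrier H \<Longrightarrow> (vnorm H x)\<^sup>2 = rip x x"
  by (simp add: vnorm_eq rip_nonneg)

lemma vnorm_nonneg: "0 \<le> vnorm H x"
  by (simp add: vnorm_def)

lemma rip_Cauchy_Schwarz:
  assumes "u \<in> carrier H" "v \<in> carrier H"
  shows "(rip u v)\<^sup>2 \<le> rip u u * rip v v"
proof (rule discriminant_nonpos)
  fix t
  have tv: "of_real t \<odot>\<^bsub>H\<^esub> v \<in> carrier H" using assms smult_carrier by simp
  have "0 \<le> rip (u \<oplus> of_real t \<odot>\<^bsub>H\<^esub> v) (u \<oplus> of_real t \<odot>\<^bsub>H\<^esub> v)"
    using assms tv by (intro rip_nonneg) simp
  also have "\<dots> = rip u u + 2 * t * rip u v + t\<^sup>2 * rip v v"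
    using assms tv rip_commute[of u v]
    by (simp add: rip_add_left rip_add_right rip_smult_left rip_smult_right algebra_simps
        power2_eq_square)
  finally show "0 \<le> rip u u + 2 * t * rip u v + t\<^sup>2 * rip v v" .
qed (use assms rip_nonneg in auto)

lemma vnorm_triangle:
  assumes "u \<in> carrier H" "v \<in> carrier H"
  shows "vnorm H (u \<oplus> v) \<le> vnorm H u + vnorm H v"
proof (rule power2_le_imp_le)
  have "rip u v \<le> vnorm H u * vnorm H v"
    using real_sqrt_le_mono[OF rip_Cauchy_Schwarz[OF assms]] assms
    by (simp add: real_sqrt_mult vnorm_eq)
  then show "(vnorm H (u \<oplus> v))\<^sup>2 \<le> (vnorm H u + vnorm H v)\<^sup>2"
    using assms rip_commute[of u v] vnorm_squared[of u] vnorm_squared[of v]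
    by (simp add: vnorm_squared rip_add_left rip_add_right power2_sum)
qed (simp add: vnorm_nonneg)

lemma minus_add_cancel: "\<lbrakk>u \<in> carrier H; v \<in> carrier H\<rbrakk> \<Longrightarrow> (u \<ominus> v) \<oplus> v = u"
  by (simp add: a_minus_def a_assoc l_neg)

lemma rip_minus:
  assumes "u \<in> carrier H" "v \<in> carrier H"
  shows "rip (u \<ominus> v) (u \<ominus> v) = rip u u + rip v v - 2 * rip u v"
proof -
  have w: "u \<ominus> v \<in> carrier H" using assms by simp
  have "u = (u \<ominus> v) \<oplus> v" using assms by (simp add: minus_add_cancel)
  then obtain w where w: "w \<in> carrier H" "w = u \<ominus> v" "u = w \<oplus> v" using w by blast
  show ?thesis
    unfolding w(2)[symmetric] unfolding w(3)
    using w(1) assms rip_commute[of w v]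
    by (simp add: rip_add_left rip_add_right)
qed

lemma vdist_eq:
  "\<lbrakk>u \<in> carrier H; v \<in> carrier H\<rbrakk> \<Longrightarrow> vdist H u v = sqrt (rip u u + rip v v - 2 * rip u v)"
  by (simp add: vdist_def vnorm_eq rip_minus)

lemma metric: "Metric_space (carrier H) (vdist H)"
proof
  fix x y z
  show "0 \<le> vdist H x y" by (simp add: vdist_def vnorm_nonneg)
  show "vdist H x y = vdist H y x"
    by (cases "x \<in> carrier H \<and> y \<in> carrier H")
      (auto simp: vdist_eq rip_commute[of x y], auto simp: vdist_def)
  assume xy: "x \<in> carrier H" "y \<in> carrier H"
  show "vdist H x y = 0 \<longleftrightarrow> x = y"
  proof
    assume "vdist H x y = 0"
    then have "ip H (x \<ominus> y) (x \<ominus> y) = 0"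
      using xy by (simp add: vdist_def vnorm_def)
    then have "x \<ominus> y = \<zero>" using xy by (intro ip_definite) auto
    then show "x = y" using xy minus_add_cancel[of x y] by simp
  qed (use xy in \<open>simp add: vdist_eq\<close>)
  assume z: "z \<in> carrier H"
  have "\<ominus> y \<oplus> (y \<oplus> \<ominus> z) = \<ominus> z" using xy z by (simp add: r_neg1)
  then have "x \<ominus> z = (x \<ominus> y) \<oplus> (y \<ominus> z)"
    using xy z by (simp add: a_minus_def a_assoc)
  then show "vdist H x z \<le> vdist H x y + vdist H y z"
    using xy z vnorm_triangle[of "x \<ominus> y" "y \<ominus> z"] by (simp add: vdist_def)
qed

lemma vnorm_diff_le_vdist:
  assumes "x \<in> carrier H" "y \<in> carrier H"
  shows "\<bar>vnorm H x - vnorm H y\<bar> \<le> vdist H x y"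
proof -
  interpret Metric_space "carrier H" "vdist H" by (rule metric)
  have "vnorm H u = vdist H u \<zero>" if "u \<in> carrier H" for u
    using that rip_zero_left[of "\<zero>"] rip_zero_left[of u] rip_commute[of u "\<zero>"]
    by (simp add: vdist_eq vnorm_eq)
  then show ?thesis
    using assms triangle[of x y "\<zero>"] triangle[of y x "\<zero>"] commute[of x y] by auto
qed

lemma continuous_vnorm:
  fixes b :: "'a::topological_space \<Rightarrow> 'v"
  assumes "continuous_map euclidean (vtopology H) b"
  shows "continuous_on UNIV (\<lambda>g. vnorm H (b g))"
proof -
  interpret Metric_space "carrier H" "vdist H" by (rule metric)
  have car: "b g \<in> carrier H" for g
    using assms by (auto simp: continuous_map_def)
  have "((\<lambda>h. vnorm H (b h)) \<longlongrightarrow> vnorm H (b g)) (nhds g)" for g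
  proof (rule tendstoI)
    fix e :: real assume "e > 0"
    have "open {x. b x \<in> mball (b g) e}"
      using assms openin_mball[of "b g" e] by (auto simp: continuous_map_def)
    moreover have "g \<in> {x. b x \<in> mball (b g) e}"
      using \<open>e > 0\<close> car by simp
    ultimately have "eventually (\<lambda>h. h \<in> {x. b x \<in> mball (b g) e}) (nhds g)"
      by (rule eventually_nhds_in_open)
    then show "eventually (\<lambda>h. dist (vnorm H (b h)) (vnorm H (b g)) < e) (nhds g)"
    proof (rule eventually_mono)
      fix h assume "h \<in> {x. b x \<in> mball (b g) e}"
      then show "dist (vnorm H (b h)) (vnorm H (b g)) < e"
        using vnorm_diff_le_vdist[OF car car, of g h] by (simp add: dist_real_def abs_minus_commute)
    qed
  qed
  moreover have "at g \<le> nhds g" for g :: 'a by (simp add: at_within_def)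
  ultimately show ?thesis
    unfolding continuous_on_def by (meson tendsto_mono)
qed

text \<open>The form in which continuity of an orbit or of a cocycle is checked: distances to the value at
  a point tend to zero near this point.\<close>

lemma continuous_map_vtopologyI:
  assumes car: "\<And>g. b g \<in> carrier H"
    and lim: "\<And>g. ((\<lambda>h. vdist H (b g) (b h)) \<longlongrightarrow> 0) (nhds g)"
  shows "continuous_map euclidean (vtopology H) b"
proof -
  interpret Metric_space "carrier H" "vdist H" by (rule metric)
  have "open {x. b x \<in> U}" if U: "openin mtopology U" for U
    unfolding open_subopen[of "{x. b x \<in> U}"]
  proof (intro ballI)
    fix g assume "g \<in> {x. b x \<in> U}"
    then obtain r where r: "r > 0" "mball (b g) r \<subseteq> U"
      using U by (auto simp: openin_mtopology)
    have "eventually (\<lambda>h. vdist H (b g) (b h) < r) (nhds g)"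
      using order_tendstoD(2)[OF lim r(1)] .
    then obtain T where "open T" "g \<in> T" "\<And>h. h \<in> T \<Longrightarrow> vdist H (b g) (b h) < r"
      by (auto simp: eventually_nhds)
    then show "\<exists>T. open T \<and> g \<in> T \<and> T \<subseteq> {x. b x \<in> U}"
      using r car by (intro exI[of _ T]) auto
  qed
  then show ?thesis using car by (auto simp: continuous_map_def)
qed

primrec vec_comb :: "('g \<Rightarrow> 'v) \<Rightarrow> (real \<times> 'g) list \<Rightarrow> 'v" where
  "vec_comb b [] = \<zero>"
| "vec_comb b (p # l) = of_real (fst p) \<odot>\<^bsub>H\<^esub> b (snd p) \<oplus> vec_comb b l"

text \<open>The Gram form of a combination is the squared norm of the corresponding vector.\<close>

lemma psd_kernel_rip:
  assumes "\<And>g. b g \<in> carrier H"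
  shows "psd_kernel (\<lambda>g h. rip (b g) (b h))"
proof -
  have car: "vec_comb b l \<in> carrier H" for l
    by (induction l) (auto simp: assms smult_carrier)
  have 1: "rip y (vec_comb b l) = comb_sum l (\<lambda>h. rip y (b h))" if "y \<in> carrier H" for y l
    using that rip_zero_left[of y] rip_commute[of y "\<zero>"]
    by (induction l) (auto simp: rip_add_right rip_smult_right assms smult_carrier car)
  have 2: "rip (vec_comb b l) y = comb_sum l (\<lambda>h. rip (b h) y)" if "y \<in> carrier H" for y l
    using that rip_zero_left[of y]
    by (induction l) (auto simp: rip_add_left rip_smult_left assms smult_carrier car)
  have "gram (\<lambda>g h. rip (b g) (b h)) l l = rip (vec_comb b l) (vec_comb b l)" for l
    by (simp add: gram_def 2[OF car] 1[OF assms])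
  then show ?thesis
    using assms car rip_nonneg rip_commute by (auto simp: psd_kernel_def)
qed

end

lemma inner_product_space_of_hilbert:
  fixes H :: "('k::real_normed_field, 'v) inner_module"
  assumes "hilbert_space cj H"
    and "\<And>a b. re (a + b) = re a + re b" "\<And>r a. re (of_real r * a) = r * re a"
      "re 1 = 1" "\<And>a. re (cj a) = re a"
  shows "inner_product_space cj re H"
  using assms unfolding hilbert_space_def by (intro inner_product_space.intro) blast+

lemma inner_product_space_real: "hilbert_space id H \<Longrightarrow> inner_product_space id id H"
  by (rule inner_product_space_of_hilbert) simp_all

lemma inner_product_space_complex: "hilbert_space cnj H \<Longrightarrow> inner_product_space cnj Re H"
  by (rule inner_product_space_of_hilbert) simp_all

subsection \<open>The kernel of a cocycle\<close>

text \<open>All the properties of a cocycle that matter for the growth of its norm, in terms of a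
  real kernel: \<open>K g h\<close> is the real part of the inner product of \<open>b g\<close> and \<open>b h\<close>, and
  \<open>K g g\<close> is the squared norm of \<open>b g\<close>.\<close>

definition cocycle_kernel :: "('g::topological_group_add \<Rightarrow> 'g \<Rightarrow> real) \<Rightarrow> bool" where
  "cocycle_kernel K \<longleftrightarrow> psd_kernel K \<and> K 0 0 = 0 \<and>
     (\<forall>g h. K (- g + h) (- g + h) = K g g + K h h - 2 * K g h) \<and>
     continuous_on UNIV (\<lambda>g. K g g)"

text \<open>The vector from \<open>b g\<close> to \<open>b h\<close> is the image of \<open>b (- g + h)\<close> under the isometry \<open>\<pi> g\<close>; expanding its
  squared norm gives the identity of a cocycle kernel.\<close>

lemma (in inner_product_space) cocycle_kernel_of_cocycle:
  assumes coc: "one_cocycle H \<pi> b"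
  shows "cocycle_kernel (\<lambda>g h. rip (b g) (b h))"
    and "rip (b g) (b g) = (vnorm H (b g))\<^sup>2"
proof -
  interpret abelian_group H by (rule abelian)
  interpret Metric_space "carrier H" "vdist H" by (rule metric)
  have car: "b g \<in> carrier H" for g
    using coc by (auto simp: one_cocycle_def continuous_map_def)
  have pi: "\<pi> g x \<in> carrier H" "ip H (\<pi> g x) (\<pi> g x) = ip H x x" "\<pi> 0 x = x"
    if "x \<in> carrier H" for g x
    using coc that by (auto simp: one_cocycle_def isometric_rep_def)
  have b: "b (g + h) = \<pi> g (b h) \<oplus> b g" for g h
    using coc by (simp add: one_cocycle_def)
  have "b 0 = b 0 \<oplus> b 0"
    using b[of 0 0] pi(3)[OF car] by simp
  then have b0: "b 0 = \<zero>" using car[of 0] by (metis add.r_cancel_one')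
  have K: "rip (b (- g + h)) (b (- g + h)) = rip (b g) (b g) + rip (b h) (b h) - 2 * rip (b g) (b h)"
    for g h
  proof -
    define u where "u = \<pi> g (b (- g + h))"
    have u: "u \<in> carrier H" "rip u u = rip (b (- g + h)) (b (- g + h))"
      using pi car by (auto simp: u_def)
    have "b h = u \<oplus> b g"
      using b[of g "- g + h"] by (simp add: u_def flip: add.assoc)
    then show ?thesis
      using u car[of g] rip_commute[of u "b g"] by (simp add: rip_add_left rip_add_right)
  qed
  show *: "rip (b g) (b g) = (vnorm H (b g))\<^sup>2" for g
    by (simp add: vnorm_squared car)
  show "cocycle_kernel (\<lambda>g h. rip (b g) (b h))"
    unfolding cocycle_kernel_def
  proof (intro conjI allI)
    show "psd_kernel (\<lambda>g h. rip (b g) (b h))" by (intro psd_kernel_rip car)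
    show "rip (b 0) (b 0) = 0" by (simp add: b0 rip_zero_left)
    have "continuous_on UNIV (\<lambda>g. (vnorm H (b g))\<^sup>2)"
      using coc by (intro continuous_intros continuous_vnorm) (simp add: one_cocycle_def)
    then show "continuous_on UNIV (\<lambda>g. rip (b g) (b g))" by (simp add: *)
  qed (rule K)
qed

section \<open>The Hilbert space of a positive kernel\<close>

text \<open>A positive kernel is a semi-inner product on combinations of points. The dual of this space
  consists of functions on the set of points, because a functional is determined by its values on
  single points, and a dual is complete without any completion having to be constructed. So the
  Hilbert space is a space of real functions on the given set, known as the reproducing kernel
  Hilbert space of the kernel.\<close>

locale reproducing_kernel =
  fixes K :: "'a \<Rightarrow> 'a \<Rightarrow> real"
  assumes psd: "psd_kernel K"
begin

definition is_bound :: "('a \<Rightarrow> real) \<Rightarrow> real \<Rightarrow> bool" where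
  "is_bound \<phi> C \<longleftrightarrow> 0 \<le> C \<and> (\<forall>l. \<bar>comb_sum l \<phi>\<bar> \<le> C * sqrt (gram K l l))"

definition bounded_functions :: "('a \<Rightarrow> real) set" where
  "bounded_functions = {\<phi>. \<exists>C. is_bound \<phi> C}"

definition dual_norm :: "('a \<Rightarrow> real) \<Rightarrow> real" where
  "dual_norm \<phi> = Inf {C. is_bound \<phi> C}"

definition kernel_section :: "(real \<times> 'a) list \<Rightarrow> 'a \<Rightarrow> real" where
  "kernel_section l x = comb_sum l (K x)"

lemma dual_norm_le:
  assumes "is_bound \<phi> C"
  shows "dual_norm \<phi> \<le> C"
  unfolding dual_norm_def
  by (rule cInf_lower) (use assms in \<open>auto intro!: bdd_belowI[of _ 0] simp: is_bound_def\<close>)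

text \<open>For each combination, the required inequality is a closed condition on the constant, so the
  infimum is attained.\<close>

lemma is_bound_dual_norm:
  assumes "\<phi> \<in> bounded_functions"
  shows "is_bound \<phi> (dual_norm \<phi>)"
proof -
  obtain C where C: "is_bound \<phi> C" using assms by (auto simp: bounded_functions_def)
  have "\<bar>comb_sum l \<phi>\<bar> \<le> dual_norm \<phi> * sqrt (gram K l l)" for l
  proof (cases "gram K l l = 0")
    case True
    have "\<bar>comb_sum l \<phi>\<bar> \<le> C * sqrt (gram K l l)" using C by (simp add: is_bound_def)
    then show ?thesis using True by simp
  next
    case False
    then have pos: "sqrt (gram K l l) > 0" using gram_nonneg[OF psd, of l] by simp
    have "\<bar>comb_sum l \<phi>\<bar> / sqrt (gram K l l) \<le> dual_norm \<phi>"
      unfolding dual_norm_def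
    proof (rule cInf_greatest)
      show "{C. is_bound \<phi> C} \<noteq> {}" using C by auto
      fix D assume "D \<in> {C. is_bound \<phi> C}"
      then show "\<bar>comb_sum l \<phi>\<bar> / sqrt (gram K l l) \<le> D"
        using pos by (simp add: is_bound_def pos_divide_le_eq)
    qed
    then show ?thesis using pos by (simp add: pos_divide_le_eq)
  qed
  moreover have "0 \<le> dual_norm \<phi>"
    unfolding dual_norm_def using C by (intro cInf_greatest) (auto simp: is_bound_def)
  ultimately show ?thesis by (simp add: is_bound_def)
qed

lemma abs_comb_sum_le:
  "\<phi> \<in> bounded_functions \<Longrightarrow> \<bar>comb_sum l \<phi>\<bar> \<le> dual_norm \<phi> * sqrt (gram K l l)"
  using is_bound_dual_norm by (simp add: is_bound_def)

lemma dual_norm_nonneg: "\<phi> \<in> bounded_functions \<Longrightarrow> 0 \<le> dual_norm \<phi>"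
  using is_bound_dual_norm by (simp add: is_bound_def)

lemma dual_norm_eqI:
  assumes "is_bound \<phi> C" "\<And>D. is_bound \<phi> D \<Longrightarrow> C \<le> D"
  shows "dual_norm \<phi> = C"
  using assms dual_norm_le is_bound_dual_norm[of \<phi>]
  by (intro antisym) (auto simp: bounded_functions_def)

lemma is_bound_zero: "is_bound (\<lambda>x. 0) 0"
  by (simp add: is_bound_def)

lemma zero_bounded: "(\<lambda>x. 0) \<in> bounded_functions"
  using is_bound_zero by (auto simp: bounded_functions_def)

lemma dual_norm_zero: "dual_norm (\<lambda>x. 0) = 0"
  by (rule dual_norm_eqI[OF is_bound_zero]) (simp add: is_bound_def)

lemma is_bound_add:
  assumes "is_bound \<phi> C" "is_bound \<psi> D"
  shows "is_bound (\<lambda>x. \<phi> x + \<psi> x) (C + D)"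
  unfolding is_bound_def
proof (intro conjI allI)
  fix l
  have "\<bar>comb_sum l \<phi>\<bar> \<le> C * sqrt (gram K l l)" "\<bar>comb_sum l \<psi>\<bar> \<le> D * sqrt (gram K l l)"
    using assms by (auto simp: is_bound_def)
  then show "\<bar>comb_sum l (\<lambda>x. \<phi> x + \<psi> x)\<bar> \<le> (C + D) * sqrt (gram K l l)"
    by (simp add: comb_sum_add algebra_simps)
qed (use assms in \<open>simp add: is_bound_def\<close>)

lemma is_bound_scale:
  assumes "is_bound \<phi> C"
  shows "is_bound (\<lambda>x. s * \<phi> x) (\<bar>s\<bar> * C)"
  unfolding is_bound_def
proof (intro conjI allI)
  fix l
  have "\<bar>s\<bar> * \<bar>comb_sum l \<phi>\<bar> \<le> \<bar>s\<bar> * (C * sqrt (gram K l l))"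
    using assms by (intro mult_left_mono) (auto simp: is_bound_def)
  then show "\<bar>comb_sum l (\<lambda>x. s * \<phi> x)\<bar> \<le> \<bar>s\<bar> * C * sqrt (gram K l l)"
    by (simp add: comb_sum_mult abs_mult mult.assoc)
qed (use assms in \<open>simp add: is_bound_def\<close>)

lemma add_bounded:
  assumes "\<phi> \<in> bounded_functions" "\<psi> \<in> bounded_functions"
  shows "(\<lambda>x. \<phi> x + \<psi> x) \<in> bounded_functions"
    and "dual_norm (\<lambda>x. \<phi> x + \<psi> x) \<le> dual_norm \<phi> + dual_norm \<psi>"
  using is_bound_add[OF assms[THEN is_bound_dual_norm]] dual_norm_le
  by (auto simp: bounded_functions_def)

lemma scale_bounded:
  assumes "\<phi> \<in> bounded_functions"
  shows "(\<lambda>x. s * \<phi> x) \<in> bounded_functions"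
    and "dual_norm (\<lambda>x. s * \<phi> x) = \<bar>s\<bar> * dual_norm \<phi>"
proof -
  have le: "dual_norm (\<lambda>x. s * \<phi> x) \<le> \<bar>s\<bar> * dual_norm \<phi>" if "\<phi> \<in> bounded_functions" for s \<phi>
    using is_bound_scale[OF is_bound_dual_norm[OF that]] by (rule dual_norm_le)
  show b: "(\<lambda>x. s * \<phi> x) \<in> bounded_functions" for s
    using is_bound_scale[OF is_bound_dual_norm[OF assms]] by (auto simp: bounded_functions_def)
  show "dual_norm (\<lambda>x. s * \<phi> x) = \<bar>s\<bar> * dual_norm \<phi>"
  proof (cases "s = 0")
    case True
    then show ?thesis by (simp add: dual_norm_zero)
  next
    case False
    have "dual_norm (\<lambda>x. inverse s * (s * \<phi> x)) \<le> \<bar>inverse s\<bar> * dual_norm (\<lambda>x. s * \<phi> x)"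
      by (rule le[OF b])
    then have "dual_norm \<phi> \<le> \<bar>inverse s\<bar> * dual_norm (\<lambda>x. s * \<phi> x)"
      using False by (simp flip: mult.assoc)
    then have "\<bar>s\<bar> * dual_norm \<phi> \<le> \<bar>s\<bar> * (\<bar>inverse s\<bar> * dual_norm (\<lambda>x. s * \<phi> x))"
      by (rule mult_left_mono) simp
    then have "\<bar>s\<bar> * dual_norm \<phi> \<le> dual_norm (\<lambda>x. s * \<phi> x)"
      using False by (simp flip: mult.assoc abs_mult)
    then show ?thesis using le[OF assms, of s] by simp
  qed
qed

lemma diff_bounded:
  assumes "\<phi> \<in> bounded_functions" "\<psi> \<in> bounded_functions"
  shows "(\<lambda>x. \<phi> x - \<psi> x) \<in> bounded_functions"
    and "dual_norm (\<lambda>x. \<phi> x - \<psi> x) = dual_norm (\<lambda>x. \<psi> x - \<phi> x)"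
proof -
  have "(\<lambda>x. \<phi> x - \<psi> x) \<in> bounded_functions"
    if "\<phi> \<in> bounded_functions" "\<psi> \<in> bounded_functions" for \<phi> \<psi>
    using add_bounded(1)[OF that(1) scale_bounded(1)[OF that(2), of "-1"]] by simp
  from this[OF assms] this[OF assms(2,1)]
  show "(\<lambda>x. \<phi> x - \<psi> x) \<in> bounded_functions"
    and "dual_norm (\<lambda>x. \<phi> x - \<psi> x) = dual_norm (\<lambda>x. \<psi> x - \<phi> x)"
    using scale_bounded(2)[of "\<lambda>x. \<psi> x - \<phi> x" "-1"] by auto
qed

lemma dual_norm_diff_triangle:
  assumes "\<phi> \<in> bounded_functions" "\<psi> \<in> bounded_functions" "\<theta> \<in> bounded_functions"
  shows "dual_norm (\<lambda>x. \<phi> x - \<theta> x) \<le> dual_norm (\<lambda>x. \<phi> x - \<psi> x) + dual_norm (\<lambda>x. \<psi> x - \<theta> x)"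
  using add_bounded(2)[OF diff_bounded(1)[OF assms(1,2)] diff_bounded(1)[OF assms(2,3)]] by simp

lemma abs_dual_norm_diff:
  assumes "\<phi> \<in> bounded_functions" "\<psi> \<in> bounded_functions"
  shows "\<bar>dual_norm \<phi> - dual_norm \<psi>\<bar> \<le> dual_norm (\<lambda>x. \<phi> x - \<psi> x)"
  using dual_norm_diff_triangle[OF assms zero_bounded]
    dual_norm_diff_triangle[OF assms(2,1) zero_bounded] diff_bounded(2)[OF assms] by simp

lemma abs_le_dual_norm:
  "\<phi> \<in> bounded_functions \<Longrightarrow> \<bar>\<phi> x\<bar> \<le> dual_norm \<phi> * sqrt (K x x)"
  using abs_comb_sum_le[of \<phi> "[(1, x)]"] by simp

lemma dual_norm_eq_0:
  assumes "\<phi> \<in> bounded_functions" "dual_norm \<phi> = 0"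
  shows "\<phi> = (\<lambda>x. 0)"
  using abs_le_dual_norm[OF assms(1)] assms(2) by auto

lemma comb_sum_kernel_section: "comb_sum m (kernel_section l) = gram K m l"
  unfolding kernel_section_def gram_def by simp

lemma kernel_section_append: "kernel_section (l @ m) = (\<lambda>x. kernel_section l x + kernel_section m x)"
  and kernel_section_scale: "kernel_section (scale_comb s l) = (\<lambda>x. s * kernel_section l x)"
  by (auto simp: kernel_section_def)

lemma is_bound_kernel_section: "is_bound (kernel_section l) (sqrt (gram K l l))"
  using abs_gram_le[OF psd] gram_nonneg[OF psd]
  by (auto simp: is_bound_def comb_sum_kernel_section mult.commute)

lemma kernel_section_bounded: "kernel_section l \<in> bounded_functions"
  using is_bound_kernel_section by (auto simp: bounded_functions_def)

lemma dual_norm_kernel_section: "dual_norm (kernel_section l) = sqrt (gram K l l)"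
proof (rule dual_norm_eqI[OF is_bound_kernel_section])
  fix D assume D: "is_bound (kernel_section l) D"
  have "sqrt (gram K l l) * sqrt (gram K l l) \<le> D * sqrt (gram K l l)"
    using D gram_nonneg[OF psd, of l] unfolding is_bound_def comb_sum_kernel_section
    by (metis abs_of_nonneg real_sqrt_mult_self abs_ge_self)
  moreover have "0 \<le> D" using D by (simp add: is_bound_def)
  ultimately show "sqrt (gram K l l) \<le> D"
    using gram_nonneg[OF psd, of l]
    by (cases "gram K l l = 0") (auto intro: mult_right_le_imp_le[of _ "sqrt (gram K l l)"])
qed

text \<open>The idea is that of the Riesz representation theorem: a nearly minimal \<open>l\<close> for
  \<open>gram K l l - 2 * comb_sum l \<phi>\<close> nearly represents \<open>\<phi>\<close>, because the quadratic
  polynomial obtained by moving in a direction \<open>m\<close> is bounded below, which bounds its linear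
  coefficient \<open>comb_sum m (kernel_section l) - comb_sum m \<phi>\<close>.\<close>

lemma kernel_section_dense:
  assumes \<phi>: "\<phi> \<in> bounded_functions" and "\<delta> > 0"
  shows "\<exists>l. dual_norm (\<lambda>x. kernel_section l x - \<phi> x) \<le> \<delta>"
proof -
  define J where "J l = gram K l l - 2 * comb_sum l \<phi>" for l
  have "- (dual_norm \<phi>)\<^sup>2 \<le> J l" for l
  proof -
    have "0 \<le> (sqrt (gram K l l) - dual_norm \<phi>)\<^sup>2" by simp
    also have "\<dots> = gram K l l - 2 * (dual_norm \<phi> * sqrt (gram K l l)) + (dual_norm \<phi>)\<^sup>2"
      using gram_nonneg[OF psd, of l] by (simp add: power2_diff)
    finally show ?thesis
      using abs_comb_sum_le[OF \<phi>, of l] unfolding J_def by linarith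
  qed
  then have bdd: "bdd_below (range J)" by (auto intro!: bdd_belowI2)
  obtain l where l: "J l < Inf (range J) + \<delta>\<^sup>2"
    using cInf_lessD[of "range J" "Inf (range J) + \<delta>\<^sup>2"] \<open>\<delta> > 0\<close> by auto
  have "is_bound (\<lambda>x. kernel_section l x - \<phi> x) \<delta>"
    unfolding is_bound_def
  proof (intro conjI allI)
    fix m
    define B where "B = comb_sum m (\<lambda>x. kernel_section l x - \<phi> x)"
    have B: "B = gram K m l - comb_sum m \<phi>"
      by (simp add: B_def comb_sum_diff comb_sum_kernel_section)
    have "B\<^sup>2 \<le> \<delta>\<^sup>2 * gram K m m"
    proof (rule discriminant_nonpos)
      fix t
      have "Inf (range J) \<le> J (l @ scale_comb t m)" using bdd by (simp add: cInf_lower)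
      also have "\<dots> = J l + 2 * t * B + t\<^sup>2 * gram K m m"
        using gram_commute[OF psd, of l m]
        by (simp add: J_def B algebra_simps power2_eq_square)
      finally show "0 \<le> \<delta>\<^sup>2 + 2 * t * B + t\<^sup>2 * gram K m m" using l by simp
    qed (rule gram_nonneg[OF psd])
    from real_sqrt_le_mono[OF this] show "\<bar>B\<bar> \<le> \<delta> * sqrt (gram K m m)"
      using \<open>\<delta> > 0\<close> by (simp add: real_sqrt_mult)
  qed (use \<open>\<delta> > 0\<close> in simp)
  then show ?thesis by (intro exI dual_norm_le)
qed

lemma kernel_section_sequence:
  assumes "\<phi> \<in> bounded_functions"
  obtains c where "(\<lambda>n. dual_norm (\<lambda>x. kernel_section (c n) x - \<phi> x)) \<longlonglongrightarrow> 0"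
proof -
  have "\<exists>l. dual_norm (\<lambda>x. kernel_section l x - \<phi> x) \<le> inverse (real (Suc n))" for n
    by (rule kernel_section_dense[OF assms]) simp
  then obtain c where c: "dual_norm (\<lambda>x. kernel_section (c n) x - \<phi> x) \<le> inverse (real (Suc n))" for n
    by metis
  have "(\<lambda>n. dual_norm (\<lambda>x. kernel_section (c n) x - \<phi> x)) \<longlonglongrightarrow> 0"
  proof (rule Lim_null_comparison[OF _ LIMSEQ_inverse_real_of_nat])
    have "norm (dual_norm (\<lambda>x. kernel_section (c n) x - \<phi> x)) \<le> inverse (real (Suc n))" for n
      using c[of n] dual_norm_nonneg[OF diff_bounded(1)[OF kernel_section_bounded assms], of "c n"]
      by simp
    then show "\<forall>\<^sub>F n in sequentially.
        norm (dual_norm (\<lambda>x. kernel_section (c n) x - \<phi> x)) \<le> inverse (real (Suc n))"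
      by simp
  qed
  then show thesis by (rule that)
qed

subsection \<open>The inner product\<close>

text \<open>The inner product is defined by polarisation from the dual norm. It is the Gram form on kernel
  sections, and bilinearity passes to the limit because these are dense.\<close>

definition dual_ip :: "('a \<Rightarrow> real) \<Rightarrow> ('a \<Rightarrow> real) \<Rightarrow> real" where
  "dual_ip \<phi> \<psi> = ((dual_norm (\<lambda>x. \<phi> x + \<psi> x))\<^sup>2 - (dual_norm (\<lambda>x. \<phi> x - \<psi> x))\<^sup>2) / 4"

lemma dual_ip_kernel_section: "dual_ip (kernel_section l) (kernel_section m) = gram K l m"
proof -
  have "(\<lambda>x. kernel_section l x + kernel_section m x) = kernel_section (l @ m)"
    by (simp add: kernel_section_append)
  moreover have "(\<lambda>x. kernel_section l x - kernel_section m x) = kernel_section (l @ scale_comb (- 1) m)"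
    by (simp add: kernel_section_append kernel_section_scale)
  moreover have "(dual_norm (kernel_section k))\<^sup>2 = gram K k k" for k
    using gram_nonneg[OF psd, of k] by (simp add: dual_norm_kernel_section)
  ultimately show ?thesis
    using gram_commute[OF psd, of m l] by (simp add: dual_ip_def)
qed

lemma dual_ip_commute:
  assumes "\<phi> \<in> bounded_functions" "\<psi> \<in> bounded_functions"
  shows "dual_ip \<phi> \<psi> = dual_ip \<psi> \<phi>"
  using diff_bounded(2)[OF assms] by (simp add: dual_ip_def add.commute)

lemma dual_ip_self:
  assumes "\<phi> \<in> bounded_functions"
  shows "dual_ip \<phi> \<phi> = (dual_norm \<phi>)\<^sup>2"
  using scale_bounded(2)[OF assms, of 2]
  by (simp add: dual_ip_def dual_norm_zero power_mult_distrib flip: mult_2)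

lemma tendsto_dual_norm:
  assumes "\<And>n. f n \<in> bounded_functions" "\<phi> \<in> bounded_functions"
    and "(\<lambda>n. dual_norm (\<lambda>x. f n x - \<phi> x)) \<longlonglongrightarrow> 0"
  shows "(\<lambda>n. dual_norm (f n)) \<longlonglongrightarrow> dual_norm \<phi>"
proof (rule LIM_zero_cancel, rule Lim_null_comparison[OF _ assms(3)])
  show "\<forall>\<^sub>F n in sequentially. norm (dual_norm (f n) - dual_norm \<phi>) \<le> dual_norm (\<lambda>x. f n x - \<phi> x)"
    using abs_dual_norm_diff[OF assms(1,2)] by simp
qed

lemma tendsto_diff_add:
  assumes "\<And>n. f n \<in> bounded_functions" "\<phi> \<in> bounded_functions"
    and "\<And>n. g n \<in> bounded_functions" "\<psi> \<in> bounded_functions"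
    and "(\<lambda>n. dual_norm (\<lambda>x. f n x - \<phi> x)) \<longlonglongrightarrow> 0"
    and "(\<lambda>n. dual_norm (\<lambda>x. g n x - \<psi> x)) \<longlonglongrightarrow> 0"
  shows "(\<lambda>n. dual_norm (\<lambda>x. (f n x + g n x) - (\<phi> x + \<psi> x))) \<longlonglongrightarrow> 0"
proof (rule Lim_null_comparison)
  show "(\<lambda>n. dual_norm (\<lambda>x. f n x - \<phi> x) + dual_norm (\<lambda>x. g n x - \<psi> x)) \<longlonglongrightarrow> 0"
    using tendsto_add[OF assms(5,6)] by simp
  have "norm (dual_norm (\<lambda>x. (f n x + g n x) - (\<phi> x + \<psi> x)))
      \<le> dual_norm (\<lambda>x. f n x - \<phi> x) + dual_norm (\<lambda>x. g n x - \<psi> x)" for n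
    using add_bounded[OF diff_bounded(1)[OF assms(1,2)] diff_bounded(1)[OF assms(3,4)], of n n]
      dual_norm_nonneg by (simp add: algebra_simps)
  then show "\<forall>\<^sub>F n in sequentially. norm (dual_norm (\<lambda>x. (f n x + g n x) - (\<phi> x + \<psi> x)))
      \<le> dual_norm (\<lambda>x. f n x - \<phi> x) + dual_norm (\<lambda>x. g n x - \<psi> x)"
    by simp
qed

lemma tendsto_diff_scale:
  assumes "\<And>n. f n \<in> bounded_functions" "\<phi> \<in> bounded_functions"
    and "(\<lambda>n. dual_norm (\<lambda>x. f n x - \<phi> x)) \<longlonglongrightarrow> 0"
  shows "(\<lambda>n. dual_norm (\<lambda>x. s * f n x - s * \<phi> x)) \<longlonglongrightarrow> 0"
proof -
  have "dual_norm (\<lambda>x. s * f n x - s * \<phi> x) = \<bar>s\<bar> * dual_norm (\<lambda>x. f n x - \<phi> x)" for n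
    using scale_bounded(2)[OF diff_bounded(1)[OF assms(1,2)], of s n] by (simp add: right_diff_distrib)
  then show ?thesis using tendsto_mult_left[OF assms(3), of "\<bar>s\<bar>"] by simp
qed

lemma tendsto_dual_ip:
  assumes f: "\<And>n. f n \<in> bounded_functions" and \<phi>: "\<phi> \<in> bounded_functions"
    and g: "\<And>n. g n \<in> bounded_functions" and \<psi>: "\<psi> \<in> bounded_functions"
    and lim: "(\<lambda>n. dual_norm (\<lambda>x. f n x - \<phi> x)) \<longlonglongrightarrow> 0"
      "(\<lambda>n. dual_norm (\<lambda>x. g n x - \<psi> x)) \<longlonglongrightarrow> 0"
  shows "(\<lambda>n. dual_ip (f n) (g n)) \<longlonglongrightarrow> dual_ip \<phi> \<psi>"
proof -
  have 1: "(\<lambda>n. dual_norm (\<lambda>x. f n x + g n x)) \<longlonglongrightarrow> dual_norm (\<lambda>x. \<phi> x + \<psi> x)"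
    by (rule tendsto_dual_norm[OF add_bounded(1)[OF f g] add_bounded(1)[OF \<phi> \<psi>]
        tendsto_diff_add[OF f \<phi> g \<psi> lim]])
  have "(\<lambda>n. dual_norm (\<lambda>x. (f n x + (-1) * g n x) - (\<phi> x + (-1) * \<psi> x))) \<longlonglongrightarrow> 0"
    by (rule tendsto_diff_add[OF f \<phi> scale_bounded(1)[OF g] scale_bounded(1)[OF \<psi>] lim(1)
        tendsto_diff_scale[OF g \<psi> lim(2)]])
  then have "(\<lambda>n. dual_norm (\<lambda>x. (f n x - g n x) - (\<phi> x - \<psi> x))) \<longlonglongrightarrow> 0" by simp
  from tendsto_dual_norm[OF diff_bounded(1)[OF f g] diff_bounded(1)[OF \<phi> \<psi>] this]
  have 2: "(\<lambda>n. dual_norm (\<lambda>x. f n x - g n x)) \<longlonglongrightarrow> dual_norm (\<lambda>x. \<phi> x - \<psi> x)" .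
  show ?thesis
    unfolding dual_ip_def by (intro tendsto_divide tendsto_diff tendsto_power 1 2 tendsto_const) simp
qed

lemma dual_ip_add:
  assumes \<phi>: "\<phi> \<in> bounded_functions" and \<psi>: "\<psi> \<in> bounded_functions" and \<theta>: "\<theta> \<in> bounded_functions"
  shows "dual_ip (\<lambda>x. \<phi> x + \<psi> x) \<theta> = dual_ip \<phi> \<theta> + dual_ip \<psi> \<theta>"
proof -
  note b = kernel_section_bounded
  obtain c where c: "(\<lambda>n. dual_norm (\<lambda>x. kernel_section (c n) x - \<phi> x)) \<longlonglongrightarrow> 0"
    using kernel_section_sequence[OF \<phi>] .
  obtain d where d: "(\<lambda>n. dual_norm (\<lambda>x. kernel_section (d n) x - \<psi> x)) \<longlonglongrightarrow> 0"
    using kernel_section_sequence[OF \<psi>] .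
  obtain e where e: "(\<lambda>n. dual_norm (\<lambda>x. kernel_section (e n) x - \<theta> x)) \<longlonglongrightarrow> 0"
    using kernel_section_sequence[OF \<theta>] .
  have "(\<lambda>n. dual_norm (\<lambda>x. kernel_section (c n @ d n) x - (\<phi> x + \<psi> x))) \<longlonglongrightarrow> 0"
    using tendsto_diff_add[OF b \<phi> b \<psi> c d] by (simp add: kernel_section_append)
  from tendsto_dual_ip[OF b add_bounded(1)[OF \<phi> \<psi>] b \<theta> this e]
  have "(\<lambda>n. gram K (c n) (e n) + gram K (d n) (e n)) \<longlonglongrightarrow> dual_ip (\<lambda>x. \<phi> x + \<psi> x) \<theta>"
    by (simp add: dual_ip_kernel_section)
  moreover have "(\<lambda>n. gram K (c n) (e n) + gram K (d n) (e n)) \<longlonglongrightarrow> dual_ip \<phi> \<theta> + dual_ip \<psi> \<theta>"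
    using tendsto_add[OF tendsto_dual_ip[OF b \<phi> b \<theta> c e] tendsto_dual_ip[OF b \<psi> b \<theta> d e]]
    by (simp add: dual_ip_kernel_section)
  ultimately show ?thesis by (rule LIMSEQ_unique)
qed

lemma dual_ip_scale:
  assumes \<phi>: "\<phi> \<in> bounded_functions" and \<theta>: "\<theta> \<in> bounded_functions"
  shows "dual_ip (\<lambda>x. s * \<phi> x) \<theta> = s * dual_ip \<phi> \<theta>"
proof -
  note b = kernel_section_bounded
  obtain c where c: "(\<lambda>n. dual_norm (\<lambda>x. kernel_section (c n) x - \<phi> x)) \<longlonglongrightarrow> 0"
    using kernel_section_sequence[OF \<phi>] .
  obtain e where e: "(\<lambda>n. dual_norm (\<lambda>x. kernel_section (e n) x - \<theta> x)) \<longlonglongrightarrow> 0"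
    using kernel_section_sequence[OF \<theta>] .
  have "(\<lambda>n. dual_norm (\<lambda>x. kernel_section (scale_comb s (c n)) x - s * \<phi> x)) \<longlonglongrightarrow> 0"
    using tendsto_diff_scale[OF b \<phi> c] by (simp add: kernel_section_scale)
  from tendsto_dual_ip[OF b scale_bounded(1)[OF \<phi>] b \<theta> this e]
  have "(\<lambda>n. s * gram K (c n) (e n)) \<longlonglongrightarrow> dual_ip (\<lambda>x. s * \<phi> x) \<theta>"
    by (simp add: dual_ip_kernel_section)
  moreover have "(\<lambda>n. s * gram K (c n) (e n)) \<longlonglongrightarrow> s * dual_ip \<phi> \<theta>"
    using tendsto_mult_left[OF tendsto_dual_ip[OF b \<phi> b \<theta> c e]]
    by (simp add: dual_ip_kernel_section)
  ultimately show ?thesis by (rule LIMSEQ_unique)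
qed

subsection \<open>The Hilbert space\<close>

definition rkhs :: "(real, 'a \<Rightarrow> real) inner_module" where
  "rkhs = \<lparr>carrier = bounded_functions, monoid.mult = (\<lambda>\<phi> \<psi>. undefined), one = undefined,
     zero = (\<lambda>x. 0), add = (\<lambda>\<phi> \<psi> x. \<phi> x + \<psi> x), smult = (\<lambda>s \<phi> x. s * \<phi> x), ip = dual_ip\<rparr>"

lemma rkhs_simps [simp]:
  "carrier rkhs = bounded_functions" "\<zero>\<^bsub>rkhs\<^esub> = (\<lambda>x. 0)"
  "\<phi> \<oplus>\<^bsub>rkhs\<^esub> \<psi> = (\<lambda>x. \<phi> x + \<psi> x)" "s \<odot>\<^bsub>rkhs\<^esub> \<phi> = (\<lambda>x. s * \<phi> x)" "ip rkhs = dual_ip"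
  by (simp_all add: rkhs_def)

lemma inner_product_space_rkhs: "inner_product_space id id rkhs"
proof (rule inner_product_space.intro)
  show "Module.module (ring_of_type_algebra :: real ring) rkhs"
  proof (rule moduleI)
    show "cring (ring_of_type_algebra :: real ring)" by (rule cring_from_type_algebra)
    show "abelian_group rkhs"
    proof (rule abelian_groupI)
      fix \<phi> assume "\<phi> \<in> carrier rkhs"
      then show "\<exists>\<psi>\<in>carrier rkhs. \<psi> \<oplus>\<^bsub>rkhs\<^esub> \<phi> = \<zero>\<^bsub>rkhs\<^esub>"
        using scale_bounded(1)[of \<phi> "-1"] by (intro bexI[of _ "\<lambda>x. (-1) * \<phi> x"]) auto
    qed (auto simp: add_bounded(1) zero_bounded algebra_simps)
  qed (auto simp: ring_of_type_algebra_def scale_bounded(1) algebra_simps)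
next
  fix \<phi> assume "\<phi> \<in> carrier rkhs"
  then show "\<exists>r\<ge>0. ip rkhs \<phi> \<phi> = of_real r"
    by (simp add: dual_ip_self)
next
  fix \<phi> assume "\<phi> \<in> carrier rkhs" "ip rkhs \<phi> \<phi> = 0"
  then show "\<phi> = \<zero>\<^bsub>rkhs\<^esub>" by (simp add: dual_ip_self dual_norm_eq_0)
qed (auto simp: dual_ip_add dual_ip_scale dual_ip_commute)

lemma vnorm_rkhs: "\<phi> \<in> bounded_functions \<Longrightarrow> vnorm rkhs \<phi> = dual_norm \<phi>"
  by (simp add: vnorm_def dual_ip_self dual_norm_nonneg)

lemma vdist_rkhs:
  assumes "\<phi> \<in> bounded_functions" "\<psi> \<in> bounded_functions"
  shows "vdist rkhs \<phi> \<psi> = dual_norm (\<lambda>x. \<phi> x - \<psi> x)"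
proof -
  have "(\<lambda>x. (\<phi> \<ominus>\<^bsub>rkhs\<^esub> \<psi>) x + \<psi> x) = \<phi>"
    using inner_product_space.minus_add_cancel[OF inner_product_space_rkhs, of \<phi> \<psi>] assms by simp
  then have "\<phi> \<ominus>\<^bsub>rkhs\<^esub> \<psi> = (\<lambda>x. \<phi> x - \<psi> x)"
    by (metis (no_types, lifting) add_diff_cancel_right')
  then show ?thesis
    using assms by (simp add: vdist_def vnorm_rkhs diff_bounded)
qed

text \<open>A Cauchy sequence converges at each point, hence on every combination, and the bounds
  that witness the Cauchy condition survive the pointwise limit.\<close>

lemma mcomplete_rkhs: "Metric_space.mcomplete (carrier rkhs) (vdist rkhs)"
proof -
  interpret Metric_space "carrier rkhs" "vdist rkhs"
    by (rule inner_product_space.metric[OF inner_product_space_rkhs])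
  show ?thesis
    unfolding mcomplete_def
  proof (intro allI impI)
    fix \<sigma> assume "MCauchy \<sigma>"
    then have "range \<sigma> \<subseteq> carrier rkhs" unfolding MCauchy_def by blast
    then have \<sigma>: "\<sigma> n \<in> bounded_functions" for n by auto
    have cau: "\<exists>N. \<forall>n\<ge>N. \<forall>m\<ge>N. dual_norm (\<lambda>x. \<sigma> n x - \<sigma> m x) < e" if "e > 0" for e
      using \<open>MCauchy \<sigma>\<close> that unfolding MCauchy_def by (simp add: vdist_rkhs \<sigma>)
    have "Cauchy (\<lambda>n. \<sigma> n x)" for x
    proof (rule metric_CauchyI)
      fix e :: real assume "e > 0"
      define s where "s = sqrt (K x x)"
      have s: "s \<ge> 0" using gram_nonneg[OF psd, of "[(1, x)]"] by (simp add: s_def)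
      \<comment> \<open>The increment by one avoids dividing by zero.\<close>
      obtain N where N: "\<And>n m. n \<ge> N \<Longrightarrow> m \<ge> N \<Longrightarrow> dual_norm (\<lambda>x. \<sigma> n x - \<sigma> m x) < e / (s + 1)"
        using cau[of "e / (s + 1)"] \<open>e > 0\<close> s by auto
      have "dist (\<sigma> n x) (\<sigma> m x) < e" if "n \<ge> N" "m \<ge> N" for n m
      proof -
        have "dist (\<sigma> n x) (\<sigma> m x) \<le> dual_norm (\<lambda>x. \<sigma> n x - \<sigma> m x) * s"
          using abs_le_dual_norm[OF diff_bounded(1)[OF \<sigma>[of n] \<sigma>[of m]], of x]
          by (simp add: dist_real_def s_def)
        also have "\<dots> \<le> e / (s + 1) * s"
          using N[OF that] s by (intro mult_right_mono) auto
        also have "\<dots> < e" using s \<open>e > 0\<close> by (simp add: field_simps)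
        finally show ?thesis .
      qed
      then show "\<exists>N. \<forall>m\<ge>N. \<forall>n\<ge>N. dist (\<sigma> m x) (\<sigma> n x) < e" by blast
    qed
    then have "\<exists>y. (\<lambda>n. \<sigma> n x) \<longlonglongrightarrow> y" for x
      using Cauchy_convergent_iff convergent_def by blast
    then obtain \<phi> where lim: "\<And>x. (\<lambda>n. \<sigma> n x) \<longlonglongrightarrow> \<phi> x" by metis
    have bound: "\<exists>N. \<forall>n\<ge>N. is_bound (\<lambda>x. \<sigma> n x - \<phi> x) e" if "e > 0" for e
    proof -
      obtain N where N: "\<And>n m. n \<ge> N \<Longrightarrow> m \<ge> N \<Longrightarrow> dual_norm (\<lambda>x. \<sigma> n x - \<sigma> m x) < e"
        using cau[OF \<open>e > 0\<close>] by auto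
      have "is_bound (\<lambda>x. \<sigma> n x - \<phi> x) e" if "n \<ge> N" for n
        unfolding is_bound_def
      proof (intro conjI allI)
        fix l
        have "(\<lambda>m. \<bar>comb_sum l (\<lambda>x. \<sigma> n x - \<sigma> m x)\<bar>) \<longlonglongrightarrow> \<bar>comb_sum l (\<lambda>x. \<sigma> n x - \<phi> x)\<bar>"
          by (intro tendsto_rabs tendsto_comb_sum tendsto_diff tendsto_const lim)
        moreover have "\<bar>comb_sum l (\<lambda>x. \<sigma> n x - \<sigma> m x)\<bar> \<le> e * sqrt (gram K l l)" if "m \<ge> N" for m
        proof -
          have "\<bar>comb_sum l (\<lambda>x. \<sigma> n x - \<sigma> m x)\<bar>
              \<le> dual_norm (\<lambda>x. \<sigma> n x - \<sigma> m x) * sqrt (gram K l l)"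
            by (rule abs_comb_sum_le[OF diff_bounded(1)[OF \<sigma> \<sigma>]])
          also have "\<dots> \<le> e * sqrt (gram K l l)"
            using N[OF \<open>n \<ge> N\<close> that] gram_nonneg[OF psd, of l] by (intro mult_right_mono) auto
          finally show ?thesis .
        qed
        ultimately show "\<bar>comb_sum l (\<lambda>x. \<sigma> n x - \<phi> x)\<bar> \<le> e * sqrt (gram K l l)"
          by (intro LIMSEQ_le_const2) auto
      qed (use \<open>e > 0\<close> in simp)
      then show ?thesis by blast
    qed
    obtain n where "is_bound (\<lambda>x. \<sigma> n x - \<phi> x) 1" using bound[of 1] by auto
    then have "(\<lambda>x. \<sigma> n x - \<phi> x) \<in> bounded_functions" by (auto simp: bounded_functions_def)
    from diff_bounded(1)[OF \<sigma>[of n] this] have \<phi>: "\<phi> \<in> bounded_functions" by simp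
    have "\<forall>\<^sub>F n in sequentially. \<sigma> n \<in> carrier rkhs \<and> vdist rkhs (\<sigma> n) \<phi> < e" if "e > 0" for e
    proof -
      obtain N where N: "\<And>n. n \<ge> N \<Longrightarrow> is_bound (\<lambda>x. \<sigma> n x - \<phi> x) (e / 2)"
        using bound[of "e / 2"] \<open>e > 0\<close> by auto
      have "vdist rkhs (\<sigma> n) \<phi> < e" if "n \<ge> N" for n
        using dual_norm_le[OF N[OF that]] \<open>e > 0\<close> by (simp add: vdist_rkhs \<sigma> \<phi>)
      then show ?thesis using \<sigma> by (auto simp: eventually_sequentially)
    qed
    then have "limitin mtopology \<sigma> \<phi> sequentially"
      unfolding limitin_metric using \<phi> by simp
    then show "\<exists>\<phi>. limitin mtopology \<sigma> \<phi> sequentially" by (intro exI[of _ \<phi>])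
  qed
qed

lemma hilbert_space_rkhs: "hilbert_space id rkhs"
  using inner_product_space_rkhs mcomplete_rkhs
  unfolding hilbert_space_def inner_product_space_def by blast

end

section \<open>The cocycle of a kernel\<close>

locale affine_kernel =
  fixes K :: "'g::topological_group_add \<Rightarrow> 'g \<Rightarrow> real"
  assumes cocycle_kernel: "cocycle_kernel K"
begin

sublocale reproducing_kernel K
  using cocycle_kernel by unfold_locales (simp add: cocycle_kernel_def)

lemma kernel_zero: "K 0 0 = 0"
  and kernel_diff: "K (- g + h) (- g + h) = K g g + K h h - 2 * K g h"
  and kernel_commute: "K g h = K h g"
  using cocycle_kernel by (auto simp: cocycle_kernel_def psd_kernel_def)

lemma kernel_nonneg: "0 \<le> K g g"
  using gram_nonneg[OF psd, of "[(1, g)]"] by simp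

lemma abs_kernel_le: "\<bar>K g h\<bar> \<le> sqrt (K g g) * sqrt (K h h)"
  using abs_gram_le[OF psd, of "[(1, g)]" "[(1, h)]"] by simp

lemma kernel_eq_0: "K g 0 = 0" "K 0 g = 0"
  using abs_kernel_le[of g 0] abs_kernel_le[of 0 g] kernel_zero by auto

lemma kernel_minus: "K (- g) (- g) = K g g"
  using kernel_diff[of g 0] kernel_eq_0 by simp

lemma sqrt_kernel_add: "sqrt (K (g + h) (g + h)) \<le> sqrt (K g g) + sqrt (K h h)"
proof (rule real_le_lsqrt)
  have "K (g + h) (g + h) = K g g + K h h - 2 * K (- g) h"
    using kernel_diff[of "- g" h] kernel_minus[of g] by simp
  also have "\<dots> \<le> K g g + K h h + 2 * (sqrt (K g g) * sqrt (K h h))"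
    using abs_kernel_le[of "- g" h] kernel_minus[of g] by simp
  also have "\<dots> = (sqrt (K g g) + sqrt (K h h))\<^sup>2"
    using kernel_nonneg[of g] kernel_nonneg[of h] by (simp add: power2_sum)
  finally show "K (g + h) (g + h) \<le> (sqrt (K g g) + sqrt (K h h))\<^sup>2" .
qed (simp add: kernel_nonneg)

lemma kernel_tendsto_0: "((\<lambda>h. K (- g + h) (- g + h)) \<longlongrightarrow> 0) (nhds g)"
proof -
  have "continuous_on UNIV (\<lambda>g. K g g)"
    using cocycle_kernel by (simp add: cocycle_kernel_def)
  moreover have "((\<lambda>h. - g + h) \<longlongrightarrow> 0) (nhds g)"
    using tendsto_add[OF tendsto_const filterlim_ident, of "- g" g] by simp
  ultimately show ?thesis
    using continuous_on_tendsto_compose[of UNIV "\<lambda>g. K g g"] kernel_zero by fastforce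
qed

text \<open>A vector \<open>v\<close> is represented by the function \<open>x \<mapsto> \<langle>v, b x\<rangle>\<close>. For a cocycle \<open>b\<close> of a
  representation \<open>\<pi>\<close>, the inverse of \<open>\<pi> g\<close> takes \<open>b x\<close> to \<open>b (- g + x) - b (- g)\<close>, so \<open>\<pi> g v\<close> is
  represented by the translate below.\<close>

definition translate :: "'g \<Rightarrow> ('g \<Rightarrow> real) \<Rightarrow> 'g \<Rightarrow> real" where
  "translate g \<phi> x = \<phi> (- g + x) - \<phi> (- g)"

text \<open>The transpose of \<open>translate g\<close>, acting on combinations.\<close>

primrec translate_comb :: "'g \<Rightarrow> (real \<times> 'g) list \<Rightarrow> (real \<times> 'g) list" where
  "translate_comb g [] = []"
| "translate_comb g (p # l) = (fst p, - g + snd p) # (- fst p, - g) # translate_comb g l"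

definition cocycle :: "'g \<Rightarrow> 'g \<Rightarrow> real" where
  "cocycle g = kernel_section [(1, g)]"

lemma cocycle_apply: "cocycle g x = K x g"
  by (simp add: cocycle_def kernel_section_def)

lemma cocycle_bounded: "cocycle g \<in> bounded_functions"
  unfolding cocycle_def by (rule kernel_section_bounded)

lemma dual_norm_cocycle: "dual_norm (cocycle g) = sqrt (K g g)"
  by (simp add: cocycle_def dual_norm_kernel_section)

lemma comb_sum_translate: "comb_sum l (translate g \<phi>) = comb_sum (translate_comb g l) \<phi>"
  by (induction l) (auto simp: translate_def algebra_simps)

text \<open>Differences \<open>b x - b y\<close> have norms that depend only on \<open>- x + y\<close>; polarisation turns
  this into invariance of inner products based at the moving point \<open>- g\<close>.\<close>

lemma kernel_translate:
  "K (- g + x) (- g + y) - K (- g + x) (- g) - (K (- g) (- g + y) - K (- g) (- g)) = K x y"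
proof -
  have "K (- x + y) (- x + y)
      = K (- g + x) (- g + x) + K (- g + y) (- g + y) - 2 * K (- g + x) (- g + y)"
    using kernel_diff[of "- g + x" "- g + y"] by (simp add: minus_add add.assoc)
  moreover have "K x x = K (- g + x) (- g + x) + K g g - 2 * K (- g + x) (- g)"
    using kernel_diff[of "- g + x" "- g"] kernel_minus[of x] kernel_minus[of g]
    by (simp add: minus_add add.assoc)
  moreover have "K y y = K g g + K (- g + y) (- g + y) - 2 * K (- g) (- g + y)"
    using kernel_diff[of "- g" "- g + y"] kernel_minus[of g] by (simp flip: add.assoc)
  ultimately show ?thesis
    using kernel_diff[of x y] kernel_minus[of g] by simp
qed

text \<open>The transposed translation preserves the semi-norm of combinations, so translation is
  isometric on the dual.\<close>

lemma gram_translate: "gram K (translate_comb g l) (translate_comb g l) = gram K l l"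
proof -
  have "gram K (translate_comb g l) (translate_comb g l)
      = comb_sum l (translate g (\<lambda>x. comb_sum l (translate g (K x))))"
    by (simp add: gram_def comb_sum_translate)
  also have "translate g (\<lambda>x. comb_sum l (translate g (K x))) = (\<lambda>x. comb_sum l (K x))"
  proof
    fix x
    have "translate g (\<lambda>x. comb_sum l (translate g (K x))) x
        = comb_sum l (\<lambda>y. translate g (K (- g + x)) y - translate g (K (- g)) y)"
      unfolding comb_sum_diff by (simp add: translate_def[abs_def])
    also have "\<dots> = comb_sum l (K x)"
      by (intro comb_sum_cong) (simp add: translate_def kernel_translate)
    finally show "translate g (\<lambda>x. comb_sum l (translate g (K x))) x = comb_sum l (K x)" .
  qed
  finally show ?thesis by (simp add: gram_def)
qed

lemma is_bound_translate: "is_bound \<phi> C \<Longrightarrow> is_bound (translate g \<phi>) C"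
  by (auto simp: is_bound_def comb_sum_translate) (metis gram_translate)

lemma translate_bounded: "\<phi> \<in> bounded_functions \<Longrightarrow> translate g \<phi> \<in> bounded_functions"
  using is_bound_translate by (auto simp: bounded_functions_def)

lemma translate_add: "translate g (\<lambda>x. \<phi> x + \<psi> x) = (\<lambda>x. translate g \<phi> x + translate g \<psi> x)"
  and translate_diff: "translate g (\<lambda>x. \<phi> x - \<psi> x) = (\<lambda>x. translate g \<phi> x - translate g \<psi> x)"
  and translate_scale: "translate g (\<lambda>x. s * \<phi> x) = (\<lambda>x. s * translate g \<phi> x)"
  by (auto simp: translate_def algebra_simps)

lemma translate_zero:
  assumes "\<phi> \<in> bounded_functions"
  shows "translate 0 \<phi> = \<phi>"
  using abs_le_dual_norm[OF assms, of 0] kernel_zero by (auto simp: translate_def)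

lemma translate_translate: "translate g (translate h \<phi>) = translate (g + h) \<phi>"
proof
  fix x
  have "- (g + h) + x = - h + (- g + x)" "- (g + h) = - h + - g"
    by (simp_all only: minus_add add.assoc)
  then show "translate g (translate h \<phi>) x = translate (g + h) \<phi> x"
    by (simp only: translate_def)
qed

lemma dual_norm_translate:
  assumes "\<phi> \<in> bounded_functions"
  shows "dual_norm (translate g \<phi>) = dual_norm \<phi>"
proof -
  have le: "dual_norm (translate g \<phi>) \<le> dual_norm \<phi>" if "\<phi> \<in> bounded_functions" for g \<phi>
    using that by (intro dual_norm_le is_bound_translate is_bound_dual_norm)
  have "translate (- g) (translate g \<phi>) = \<phi>"
    by (simp add: translate_translate translate_zero assms)
  then show ?thesis
    using le[OF assms, of g] le[OF translate_bounded[OF assms], of "- g" g] by simp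
qed

lemma dual_ip_translate:
  assumes "\<phi> \<in> bounded_functions" "\<psi> \<in> bounded_functions"
  shows "dual_ip (translate g \<phi>) (translate g \<psi>) = dual_ip \<phi> \<psi>"
  using dual_norm_translate[OF add_bounded(1)[OF assms], of g]
    dual_norm_translate[OF diff_bounded(1)[OF assms], of g]
  by (simp add: dual_ip_def translate_add translate_diff)

lemma cocycle_add: "cocycle (g + h) x = translate g (cocycle h) x + cocycle g x"
proof -
  have "K (- (g + h) + x) (- (g + h) + x)
      = K (- g + x) (- g + x) + K h h - 2 * K (- g + x) h"
    using kernel_diff[of h "- g + x"] kernel_commute[of h "- g + x"]
    unfolding minus_add add.assoc by simp
  moreover have "K (g + h) (g + h) = K g g + K h h - 2 * K (- g) h"
    using kernel_diff[of "- g" h] kernel_minus[of g] by simp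
  ultimately show ?thesis
    using kernel_diff[of "g + h" x] kernel_diff[of g x]
      kernel_commute[of x "g + h"] kernel_commute[of x g]
    by (simp add: cocycle_apply translate_def)
qed

lemma dual_norm_cocycle_diff:
  "dual_norm (\<lambda>x. cocycle g x - cocycle h x) = sqrt (K (- g + h) (- g + h))"
proof -
  have "(\<lambda>x. cocycle g x - cocycle h x) = kernel_section [(1, g), (- 1, h)]"
    by (auto simp: cocycle_def kernel_section_def)
  moreover have "gram K [(1, g), (- 1, h)] [(1, g), (- 1, h)] = K (- g + h) (- g + h)"
    using kernel_commute[of g h] by (simp add: gram_def kernel_diff)
  ultimately show ?thesis by (simp add: dual_norm_kernel_section)
qed

lemma cocycle_continuous: "((\<lambda>h. dual_norm (\<lambda>x. cocycle g x - cocycle h x)) \<longlongrightarrow> 0) (nhds g)"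
  using tendsto_real_sqrt[OF kernel_tendsto_0] by (simp add: dual_norm_cocycle_diff)

subsection \<open>Continuity of the representation\<close>

definition orbit_continuous :: "('g \<Rightarrow> real) \<Rightarrow> bool" where
  "orbit_continuous \<phi> \<longleftrightarrow>
     (\<forall>g. ((\<lambda>h. dual_norm (\<lambda>x. translate g \<phi> x - translate h \<phi> x)) \<longlongrightarrow> 0) (nhds g))"

text \<open>The orbit of a cocycle value is again expressed by the cocycle, whose continuity is
  that of the kernel on the diagonal at the unit.\<close>

lemma orbit_continuous_cocycle: "orbit_continuous (cocycle y)"
  unfolding orbit_continuous_def
proof
  fix g
  note b = cocycle_bounded
  have "((\<lambda>h. h + y) \<longlongrightarrow> g + y) (nhds g)"
    by (intro tendsto_add tendsto_const filterlim_ident)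
  then have "((\<lambda>h. dual_norm (\<lambda>x. cocycle (g + y) x - cocycle (h + y) x)) \<longlongrightarrow> 0) (nhds g)"
    by (rule filterlim_compose[OF cocycle_continuous])
  from tendsto_add[OF this cocycle_continuous]
  have lim: "((\<lambda>h. dual_norm (\<lambda>x. cocycle (g + y) x - cocycle (h + y) x)
      + dual_norm (\<lambda>x. cocycle g x - cocycle h x)) \<longlongrightarrow> 0) (nhds g)" by simp
  have "dual_norm (\<lambda>x. translate g (cocycle y) x - translate h (cocycle y) x)
      \<le> dual_norm (\<lambda>x. cocycle (g + y) x - cocycle (h + y) x)
        + dual_norm (\<lambda>x. cocycle g x - cocycle h x)" for h
  proof -
    have "translate g (cocycle y) x - translate h (cocycle y) x
        = (cocycle (g + y) x - cocycle (h + y) x) + (cocycle h x - cocycle g x)" for x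
      by (simp add: cocycle_add)
    then show ?thesis
      using add_bounded(2)[OF diff_bounded(1)[OF b[of "g + y"] b[of "h + y"]]
          diff_bounded(1)[OF b[of h] b[of g]]]
        diff_bounded(2)[OF b[of g] b[of h]] by simp
  qed
  then show "((\<lambda>h. dual_norm (\<lambda>x. translate g (cocycle y) x - translate h (cocycle y) x))
      \<longlongrightarrow> 0) (nhds g)"
    by (intro Lim_null_comparison[OF _ lim] always_eventually allI)
      (simp add: dual_norm_nonneg diff_bounded translate_bounded b)
qed

lemma orbit_continuous_add:
  assumes "\<phi> \<in> bounded_functions" "\<psi> \<in> bounded_functions"
    and "orbit_continuous \<phi>" "orbit_continuous \<psi>"
  shows "orbit_continuous (\<lambda>x. s * \<phi> x + \<psi> x)"
  unfolding orbit_continuous_def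
proof
  fix g
  note b = diff_bounded(1)[OF translate_bounded translate_bounded]
  have lim: "((\<lambda>h. \<bar>s\<bar> * dual_norm (\<lambda>x. translate g \<phi> x - translate h \<phi> x)
      + dual_norm (\<lambda>x. translate g \<psi> x - translate h \<psi> x)) \<longlongrightarrow> 0) (nhds g)"
    using assms(3,4) by (auto simp: orbit_continuous_def intro!: tendsto_add_zero tendsto_mult_right_zero)
  have "dual_norm (\<lambda>x. translate g (\<lambda>x. s * \<phi> x + \<psi> x) x - translate h (\<lambda>x. s * \<phi> x + \<psi> x) x)
      \<le> \<bar>s\<bar> * dual_norm (\<lambda>x. translate g \<phi> x - translate h \<phi> x)
        + dual_norm (\<lambda>x. translate g \<psi> x - translate h \<psi> x)" for h
  proof -
    have "translate g (\<lambda>x. s * \<phi> x + \<psi> x) x - translate h (\<lambda>x. s * \<phi> x + \<psi> x) x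
        = s * (translate g \<phi> x - translate h \<phi> x) + (translate g \<psi> x - translate h \<psi> x)" for x
      by (simp add: translate_def algebra_simps)
    then show ?thesis
      using add_bounded(2)[OF scale_bounded(1)[OF b[OF assms(1,1), of g h], of s] b[OF assms(2,2), of g h]]
        scale_bounded(2)[OF b[OF assms(1,1), of g h], of s] by simp
  qed
  then show "((\<lambda>h. dual_norm (\<lambda>x. translate g (\<lambda>x. s * \<phi> x + \<psi> x) x
      - translate h (\<lambda>x. s * \<phi> x + \<psi> x) x)) \<longlongrightarrow> 0) (nhds g)"
    by (intro Lim_null_comparison[OF _ lim] always_eventually allI)
      (simp add: dual_norm_nonneg diff_bounded translate_bounded add_bounded scale_bounded assms)
qed

lemma orbit_continuous_kernel_section: "orbit_continuous (kernel_section l)"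
proof (induction l)
  case Nil
  have "kernel_section [] = (\<lambda>x. 0)" by (auto simp: kernel_section_def)
  then show ?case by (simp add: orbit_continuous_def translate_def dual_norm_zero)
next
  case (Cons p l)
  have "kernel_section (p # l) = (\<lambda>x. fst p * cocycle (snd p) x + kernel_section l x)"
    by (cases p) (auto simp: kernel_section_def cocycle_apply)
  then show ?case
    using orbit_continuous_add[OF cocycle_bounded kernel_section_bounded
        orbit_continuous_cocycle Cons.IH] by simp
qed

text \<open>The translations are isometric, so the set of vectors with continuous orbit is closed; it
  contains the dense set of kernel sections.\<close>

lemma orbit_continuous_bounded:
  assumes \<phi>: "\<phi> \<in> bounded_functions"
  shows "orbit_continuous \<phi>"
  unfolding orbit_continuous_def
proof (intro allI tendstoI)
  fix g :: 'g and e :: real assume "e > 0"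
  obtain l where l: "dual_norm (\<lambda>x. kernel_section l x - \<phi> x) \<le> e / 4"
    using kernel_section_dense[OF \<phi>, of "e / 4"] \<open>e > 0\<close> by auto
  define \<theta> where "\<theta> = kernel_section l"
  have \<theta>: "\<theta> \<in> bounded_functions" unfolding \<theta>_def by (rule kernel_section_bounded)
  have near: "dual_norm (\<lambda>x. translate h \<theta> x - translate h \<phi> x) \<le> e / 4" for h
    using dual_norm_translate[OF diff_bounded(1)[OF \<theta> \<phi>], of h] l
    by (simp add: translate_diff \<theta>_def)
  have "\<forall>\<^sub>F h in nhds g. dual_norm (\<lambda>x. translate g \<theta> x - translate h \<theta> x) < e / 4"
  proof (rule order_tendstoD(2))
    show "((\<lambda>h. dual_norm (\<lambda>x. translate g \<theta> x - translate h \<theta> x)) \<longlongrightarrow> 0) (nhds g)"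
      using orbit_continuous_kernel_section[of l] by (simp add: orbit_continuous_def \<theta>_def)
  qed (use \<open>e > 0\<close> in simp)
  \<comment> \<open>Three distances: two from approximating the vector, one along the orbit of the approximant.\<close>
  then show "\<forall>\<^sub>F h in nhds g.
      dist (dual_norm (\<lambda>x. translate g \<phi> x - translate h \<phi> x)) 0 < e"
  proof (rule eventually_mono)
    fix h assume h: "dual_norm (\<lambda>x. translate g \<theta> x - translate h \<theta> x) < e / 4"
    note t\<phi> = translate_bounded[OF \<phi>] and t\<theta> = translate_bounded[OF \<theta>]
    have "dual_norm (\<lambda>x. translate g \<phi> x - translate h \<phi> x)
        \<le> dual_norm (\<lambda>x. translate g \<phi> x - translate g \<theta> x)
          + (dual_norm (\<lambda>x. translate g \<theta> x - translate h \<theta> x)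
            + dual_norm (\<lambda>x. translate h \<theta> x - translate h \<phi> x))"
      using dual_norm_diff_triangle[OF t\<phi>[of g] t\<theta>[of g] t\<phi>[of h]]
        dual_norm_diff_triangle[OF t\<theta>[of g] t\<theta>[of h] t\<phi>[of h]] by linarith
    also have "\<dots> < e"
      using h near[of g] near[of h] diff_bounded(2)[OF t\<phi>[of g] t\<theta>[of g]] \<open>e > 0\<close> by linarith
    finally show "dist (dual_norm (\<lambda>x. translate g \<phi> x - translate h \<phi> x)) 0 < e"
      using dual_norm_nonneg[OF diff_bounded(1)[OF t\<phi>[of g] t\<phi>[of h]]] by simp
  qed
qed

theorem orthogonal_cocycle_rkhs: "orthogonal_cocycle rkhs translate cocycle"
proof -
  interpret H: inner_product_space id id rkhs by (rule inner_product_space_rkhs)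
  have orbit: "continuous_map euclidean (vtopology rkhs) (\<lambda>g. translate g \<phi>)"
    if \<phi>: "\<phi> \<in> bounded_functions" for \<phi>
  proof (rule H.continuous_map_vtopologyI)
    fix g
    show "((\<lambda>h. vdist rkhs (translate g \<phi>) (translate h \<phi>)) \<longlongrightarrow> 0) (nhds g)"
      using orbit_continuous_bounded[OF \<phi>]
      by (simp add: orbit_continuous_def vdist_rkhs translate_bounded \<phi>)
  qed (simp add: translate_bounded \<phi>)
  have "continuous_map euclidean (vtopology rkhs) cocycle"
  proof (rule H.continuous_map_vtopologyI)
    fix g
    show "((\<lambda>h. vdist rkhs (cocycle g) (cocycle h)) \<longlongrightarrow> 0) (nhds g)"
      using cocycle_continuous by (simp add: vdist_rkhs cocycle_bounded)
  qed (simp add: cocycle_bounded)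
  moreover have "isometric_rep rkhs translate"
    unfolding isometric_rep_def
    using orbit translate_bounded dual_ip_translate translate_zero
    by (auto simp: translate_add translate_scale translate_translate)
  ultimately show ?thesis
    using hilbert_space_rkhs cocycle_add
    by (auto simp: orthogonal_cocycle_def one_cocycle_def)
qed

lemma vnorm_cocycle: "vnorm rkhs (cocycle g) = sqrt (K g g)"
  by (simp add: vnorm_rkhs cocycle_bounded dual_norm_cocycle)

end

section \<open>Bernstein functions of a kernel\<close>

lemma one_minus_exp_le: "1 - exp (- x) \<le> x" for x :: real
  using exp_ge_add_one_self[of "- x"] by simp

lemma one_minus_exp_ge:
  assumes "0 \<le> x" "x \<le> (1::real)"
  shows "x / 2 \<le> 1 - exp (- x)"
proof -
  have "(1 + x) * exp (- x) \<le> exp x * exp (- x)"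
    by (intro mult_right_mono exp_ge_add_one_self) simp
  then have "exp (- x) \<le> 1 / (1 + x)"
    using assms by (simp add: exp_minus field_simps)
  also have "\<dots> \<le> 1 - x / 2"
  proof -
    have "x * x \<le> 1 * x" using assms by (intro mult_right_mono) auto
    then show ?thesis using assms by (subst pos_divide_le_eq) (auto simp: algebra_simps)
  qed
  finally show ?thesis by simp
qed

locale weighted_scales =
  fixes T :: "nat \<Rightarrow> real"
  assumes T_pos: "T n > 0"
begin

definition scale_term :: "real \<Rightarrow> nat \<Rightarrow> real" where
  "scale_term s n = (1 / 2) ^ n * (T n * (1 - exp (- (s / T n))))"

text \<open>A Bernstein function. Its \<open>n\<close>-th summand has slope at most \<open>(1 / 2) ^ n\<close>, is comparable to \<open>(1 / 2) ^ n * s\<close>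
  up to the scale \<open>T n\<close>, and stays below \<open>(1 / 2) ^ n * T n\<close> beyond it. Letting the scales grow fast
  makes its quotient by \<open>s\<close> decrease as slowly as desired.\<close>

definition bernstein :: "real \<Rightarrow> real" where
  "bernstein s = (\<Sum>n. scale_term s n)"

lemma scale_term_nonneg: "0 \<le> s \<Longrightarrow> 0 \<le> scale_term s n"
  using T_pos[of n] by (simp add: scale_term_def)

lemma scale_term_le_T: "0 \<le> s \<Longrightarrow> scale_term s n \<le> (1 / 2) ^ n * T n"
  using T_pos[of n] by (simp add: scale_term_def mult_le_cancel_left1)

lemma scale_term_diff_le:
  assumes "0 \<le> s" "s \<le> t"
  shows "scale_term t n - scale_term s n \<le> (1 / 2) ^ n * (t - s)"
    and "scale_term s n \<le> scale_term t n"
proof -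
  define d where "d = exp (- (s / T n)) * (1 - exp (- ((t - s) / T n)))"
  have eq: "scale_term t n - scale_term s n = (1 / 2) ^ n * (T n * d)"
  proof -
    have "exp (- (t / T n)) = exp (- (s / T n)) * exp (- ((t - s) / T n))"
      by (simp add: diff_divide_distrib flip: exp_add)
    then show ?thesis by (simp add: scale_term_def d_def algebra_simps)
  qed
  have "d \<ge> 0" using assms T_pos[of n] by (simp add: d_def)
  then show "scale_term s n \<le> scale_term t n"
    using eq T_pos[of n] by (simp add: algebra_simps)
  have "d \<le> 1 * ((t - s) / T n)"
    unfolding d_def using assms T_pos[of n]
    by (intro mult_mono one_minus_exp_le) auto
  then have "T n * d \<le> t - s" using T_pos[of n] by (simp add: field_simps)
  then show "scale_term t n - scale_term s n \<le> (1 / 2) ^ n * (t - s)"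
    unfolding eq by (intro mult_left_mono) auto
qed

lemma scale_term_zero [simp]: "scale_term 0 n = 0"
  by (simp add: scale_term_def)

lemma scale_term_le: "0 \<le> s \<Longrightarrow> scale_term s n \<le> (1 / 2) ^ n * s"
  using scale_term_diff_le(1)[of 0 s n] by simp

lemma summable_scale_term: "0 \<le> s \<Longrightarrow> summable (scale_term s)"
  by (rule summable_comparison_test'[of "\<lambda>n. (1 / 2) ^ n * s" 0])
    (auto simp: scale_term_nonneg scale_term_le intro!: summable_mult2 summable_geometric)

lemma bernstein_zero [simp]: "bernstein 0 = 0"
  by (simp add: bernstein_def)

lemma scale_term_le_bernstein: "0 \<le> s \<Longrightarrow> scale_term s n \<le> bernstein s"
  unfolding bernstein_def
  using sum_le_suminf[OF summable_scale_term, of s "{n}"] scale_term_nonneg by simp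

lemma bernstein_nonneg: "0 \<le> s \<Longrightarrow> 0 \<le> bernstein s"
  using scale_term_le_bernstein[of s 0] scale_term_nonneg[of s 0] by simp

lemma bernstein_Lipschitz:
  assumes "0 \<le> s" "s \<le> t"
  shows "\<bar>bernstein t - bernstein s\<bar> \<le> 2 * (t - s)"
proof -
  have sm: "summable (scale_term s)" "summable (scale_term t)"
    using assms by (auto intro: summable_scale_term)
  have geo: "(\<lambda>n. (1 / 2) ^ n * (t - s)) sums (2 * (t - s))"
    using sums_mult2[OF geometric_sums[of "1 / 2 :: real"], of "t - s"] by simp
  have "bernstein t - bernstein s = (\<Sum>n. scale_term t n - scale_term s n)"
    unfolding bernstein_def by (rule suminf_diff[OF sm(2,1)])
  also have "\<dots> \<le> (\<Sum>n. (1 / 2) ^ n * (t - s))"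
    using scale_term_diff_le(1)[OF assms] sm geo
    by (intro suminf_le summable_diff) (auto simp: sums_iff)
  also have "\<dots> = 2 * (t - s)" using geo by (simp add: sums_iff)
  finally have "bernstein t - bernstein s \<le> 2 * (t - s)" .
  moreover have "bernstein s \<le> bernstein t"
    unfolding bernstein_def using scale_term_diff_le(2)[OF assms] sm by (intro suminf_le)
  ultimately show ?thesis by simp
qed

lemma continuous_bernstein: "continuous_on {0..} bernstein"
proof (rule lipschitz_on_continuous_on[of 2], rule lipschitz_onI)
  fix s t :: real assume "s \<in> {0..}" "t \<in> {0..}"
  then show "dist (bernstein s) (bernstein t) \<le> 2 * dist s t"
    using bernstein_Lipschitz[of s t] bernstein_Lipschitz[of t s]
    by (cases "s \<le> t") (auto simp: dist_real_def abs_minus_commute)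
qed simp

text \<open>The first terms of the series are bounded, and the remaining ones add up to a small
  multiple of \<open>s\<close>.\<close>

lemma bernstein_sublinear:
  assumes "\<epsilon> > 0"
  obtains C where "\<And>s. 0 \<le> s \<Longrightarrow> bernstein s \<le> C + \<epsilon> * s"
proof -
  obtain N where N: "(1 / 2 :: real) ^ N < \<epsilon> / 2"
    using real_arch_pow_inv[of "\<epsilon> / 2" "1 / 2"] assms by auto
  have "bernstein s \<le> (\<Sum>n<N. (1 / 2) ^ n * T n) + \<epsilon> * s" if s: "0 \<le> s" for s
  proof -
    have geo: "(\<lambda>n. (1 / 2) ^ (n + N) * s) sums (2 * (1 / 2) ^ N * s)"
      using sums_mult2[OF geometric_sums[of "1 / 2 :: real"], of "(1 / 2) ^ N * s"]
      by (simp add: power_add mult.assoc)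
    have "bernstein s = (\<Sum>n. scale_term s (n + N)) + (\<Sum>n<N. scale_term s n)"
      unfolding bernstein_def by (rule suminf_split_initial_segment[OF summable_scale_term[OF s]])
    moreover have "(\<Sum>n<N. scale_term s n) \<le> (\<Sum>n<N. (1 / 2) ^ n * T n)"
      by (intro sum_mono scale_term_le_T s)
    moreover have "(\<Sum>n. scale_term s (n + N)) \<le> (\<Sum>n. (1 / 2) ^ (n + N) * s)"
      using geo summable_scale_term[OF s]
      by (intro suminf_le scale_term_le s) (auto simp: sums_iff summable_iff_shift)
    moreover have "(\<Sum>n. (1 / 2) ^ (n + N) * s) = 2 * (1 / 2) ^ N * s"
      using geo by (simp add: sums_iff)
    moreover have "2 * (1 / 2) ^ N * s \<le> \<epsilon> * s"
      using N s by (intro mult_right_mono) auto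
    ultimately show ?thesis by linarith
  qed
  then show thesis by (rule that)
qed

lemma bernstein_ge:
  assumes "0 \<le> s" "s \<le> T n"
  shows "(1 / 2) ^ n * (s / 2) \<le> bernstein s"
proof -
  have "T n * (s / T n / 2) \<le> T n * (1 - exp (- (s / T n)))"
    using assms T_pos[of n] by (intro mult_left_mono one_minus_exp_ge) auto
  then have "(1 / 2) ^ n * (s / 2) \<le> scale_term s n"
    unfolding scale_term_def using T_pos[of n] by (intro mult_left_mono) auto
  then show ?thesis using scale_term_le_bernstein[OF assms(1), of n] by simp
qed

end

text \<open>Schoenberg's theorem for \<open>1 - exp (- s / t)\<close>. With \<open>u g = exp (- K g g / t)\<close>, the third
  exponential is \<open>u g * u h * exp (2 * K g h / t)\<close>, and the expression splits as
  \<open>(1 - u g) * (1 - u h) + u g * u h * (exp (2 * K g h / t) - 1)\<close>: a rank-one kernel plus a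
  weighted positive kernel.\<close>

lemma (in affine_kernel) psd_kernel_one_minus_exp:
  assumes "t > 0"
  shows "psd_kernel (\<lambda>g h. (1 - exp (- (K g g / t))) + (1 - exp (- (K h h / t)))
    - (1 - exp (- (K (- g + h) (- g + h) / t))))"
proof -
  define u where "u g = exp (- (K g g / t))" for g
  have "psd_kernel (\<lambda>g h. exp (2 / t * K g h) - 1)"
    using assms by (intro psd_kernel_exp_minus_1 psd_kernel_scale psd) simp
  then have "psd_kernel (\<lambda>g h. (1 - u g) * (1 - u h) + u g * u h * (exp (2 / t * K g h) - 1))"
    by (intro psd_kernel_add psd_kernel_square psd_kernel_weight)
  moreover have "(1 - u g) * (1 - u h) + u g * u h * (exp (2 / t * K g h) - 1)
      = (1 - exp (- (K g g / t))) + (1 - exp (- (K h h / t)))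
        - (1 - exp (- (K (- g + h) (- g + h) / t)))" for g h
  proof -
    have "u g * u h * exp (2 / t * K g h) = exp (- (K (- g + h) (- g + h) / t))"
      by (simp add: u_def kernel_diff diff_divide_distrib add_divide_distrib flip: exp_add)
    then show ?thesis by (simp add: u_def algebra_simps)
  qed
  ultimately show ?thesis by simp
qed

text \<open>A Bernstein function of the squared norm of a cocycle is again the squared norm of a cocycle:
  the kernel recovered from it by polarisation is a limit of sums of the kernels above.\<close>

lemma cocycle_kernel_bernstein:
  assumes "affine_kernel K" "weighted_scales T"
  defines "F \<equiv> weighted_scales.bernstein T"
  defines "L \<equiv> \<lambda>g h. (F (K g g) + F (K h h) - F (K (- g + h) (- g + h))) / 2"
  shows "cocycle_kernel L"
proof -
  interpret K: affine_kernel K by fact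
  interpret T: weighted_scales T by fact
  have F: "F = T.bernstein" by (simp add: F_def)
  have diag: "L g g = F (K g g)" for g
    by (simp add: L_def F K.kernel_zero)
  have "psd_kernel L"
  proof (rule psd_kernel_limit)
    fix N
    show "psd_kernel (\<lambda>g h. \<Sum>n<N. (1 / 2) ^ n * T n / 2 *
      ((1 - exp (- (K g g / T n))) + (1 - exp (- (K h h / T n)))
        - (1 - exp (- (K (- g + h) (- g + h) / T n)))))"
      using T.T_pos
      by (intro psd_kernel_sum psd_kernel_scale K.psd_kernel_one_minus_exp) (auto simp: less_imp_le)
  next
    fix g h
    have "(\<lambda>N. \<Sum>n<N. T.scale_term (K x x) n) \<longlonglongrightarrow> F (K x x)" for x
      unfolding F T.bernstein_def
      by (rule summable_LIMSEQ[OF T.summable_scale_term[OF K.kernel_nonneg]])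
    note lim = this
    have "(\<lambda>N. ((\<Sum>n<N. T.scale_term (K g g) n) + (\<Sum>n<N. T.scale_term (K h h) n)
        - (\<Sum>n<N. T.scale_term (K (- g + h) (- g + h)) n)) / 2) \<longlonglongrightarrow> L g h"
      unfolding L_def by (intro tendsto_intros lim) simp
    moreover have "((\<Sum>n<N. T.scale_term (K g g) n) + (\<Sum>n<N. T.scale_term (K h h) n)
        - (\<Sum>n<N. T.scale_term (K (- g + h) (- g + h)) n)) / 2
      = (\<Sum>n<N. (1 / 2) ^ n * T n / 2 *
      ((1 - exp (- (K g g / T n))) + (1 - exp (- (K h h / T n)))
        - (1 - exp (- (K (- g + h) (- g + h) / T n)))))" for N
      unfolding sum.distrib[symmetric] sum_subtractf[symmetric] sum_divide_distrib
      by (intro sum.cong refl) (simp add: T.scale_term_def field_simps)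
    ultimately show "(\<lambda>N. \<Sum>n<N. (1 / 2) ^ n * T n / 2 *
      ((1 - exp (- (K g g / T n))) + (1 - exp (- (K h h / T n)))
        - (1 - exp (- (K (- g + h) (- g + h) / T n))))) \<longlonglongrightarrow> L g h" by simp
  qed
  moreover have "continuous_on UNIV (\<lambda>g. F (K g g))"
    unfolding F using K.cocycle_kernel K.kernel_nonneg
    by (intro continuous_on_compose2[OF T.continuous_bernstein]) (auto simp: cocycle_kernel_def)
  ultimately show ?thesis
    by (auto simp: cocycle_kernel_def diag) (auto simp: L_def F K.kernel_zero)
qed

section \<open>Word length\<close>

lemma word_length_witness:
  assumes "generates_group S"
  obtains xs where "word_over S xs" "length xs = word_length S g" "sum_list xs = g"
proof -
  have "\<exists>n xs. word_over S xs \<and> length xs = n \<and> sum_list xs = g"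
    using assms by (auto simp: generates_group_def)
  from LeastI_ex[OF this] show thesis
    using that by (auto simp: word_length_def)
qed

lemma compact_continuous_bounded:
  fixes \<phi> :: "'a::topological_space \<Rightarrow> real"
  assumes "continuous_on UNIV \<phi>" "compact Q"
  shows "\<exists>R. \<forall>x\<in>Q. \<phi> x \<le> R"
proof -
  have "compact (\<phi> ` Q)"
    using assms by (intro compact_continuous_image) (auto intro: continuous_on_subset)
  then have "bdd_above (\<phi> ` Q)"
    by (intro bounded_imp_bdd_above compact_imp_bounded)
  then show ?thesis by (auto simp: bdd_above_def)
qed

text \<open>Words of length \<open>n\<close> in the closure of \<open>S\<close> and its inverses are a continuous image of
  an \<open>n\<close>-fold product of compact sets.\<close>

lemma word_balls_relatively_compact:
  fixes S :: "'g::topological_group_add set"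
  assumes S: "compact (closure S)" "generates_group S"
  obtains Q where "compact Q" "\<And>g. g \<notin> Q \<Longrightarrow> R < real (word_length S g)"
proof -
  \<comment> \<open>\<open>B n\<close> consists of the words of length \<open>n\<close> over \<open>A\<close>.\<close>
  define A where "A = closure S \<union> uminus ` closure S"
  have A: "compact A"
    unfolding A_def by (intro compact_Un S(1) compact_continuous_image continuous_intros)
  define B where "B = rec_nat {0} (\<lambda>_ B. (\<lambda>(x, y). x + y) ` (A \<times> B))"
  have B: "compact (B n)" for n
  proof (induction n)
    case (Suc n)
    have "continuous_on (A \<times> B n) (\<lambda>p. fst p + snd p :: 'g)"
      by (intro continuous_intros)
    then show ?case
      using compact_continuous_image[OF _ compact_Times[OF A Suc]]
      by (simp add: B_def case_prod_unfold)
  qed (simp add: B_def)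
  have sum_in_B: "sum_list xs \<in> B (length xs)" if "word_over S xs" for xs
    using that
  proof (induction xs)
    case (Cons x xs)
    then have "x \<in> A" "sum_list xs \<in> B (length xs)"
      using closure_subset[of S] by (auto simp: word_over_def A_def)
    then show ?case by (force simp: B_def)
  qed (simp add: B_def)
  show thesis
  proof
    show "compact (\<Union>n\<le>nat \<lfloor>R\<rfloor>. B n)" by (intro compact_UN B) simp
    fix g assume g: "g \<notin> (\<Union>n\<le>nat \<lfloor>R\<rfloor>. B n)"
    obtain xs where "word_over S xs" "length xs = word_length S g" "sum_list xs = g"
      using word_length_witness[OF S(2)] .
    then have "g \<in> B (word_length S g)" using sum_in_B by metis
    then have "\<not> word_length S g \<le> nat \<lfloor>R\<rfloor>" using g by auto
    then show "R < real (word_length S g)" by linarith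
  qed
qed

text \<open>The norm of a cocycle is subadditive, and it is bounded on the compact closure of \<open>S\<close>.\<close>

lemma (in affine_kernel) sqrt_kernel_le_word_length:
  assumes S: "compact (closure S)" "generates_group S"
  obtains C where "C > 0" "\<And>g. sqrt (K g g) \<le> C * real (word_length S g)"
proof -
  have cont: "continuous_on UNIV (\<lambda>g. K g g)"
    using cocycle_kernel by (simp add: cocycle_kernel_def)
  obtain R where R: "\<And>g. g \<in> closure S \<Longrightarrow> K g g \<le> R"
    using compact_continuous_bounded[OF cont S(1)] by blast
  define C where "C = sqrt \<bar>R\<bar> + 1"
  have "C > 0" by (simp add: C_def add_nonneg_pos)
  have gen: "sqrt (K x x) \<le> C" if "x \<in> S \<union> uminus ` S" for x
  proof -
    have "\<exists>y\<in>closure S. K x x = K y y"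
      using that closure_subset[of S] kernel_minus by auto
    then have "K x x \<le> \<bar>R\<bar>" using R by force
    then have "sqrt (K x x) \<le> sqrt \<bar>R\<bar>" by (rule real_sqrt_le_mono)
    then show ?thesis unfolding C_def by linarith
  qed
  have word: "sqrt (K (sum_list xs) (sum_list xs)) \<le> C * real (length xs)" if "word_over S xs" for xs
    using that
  proof (induction xs)
    case (Cons x xs)
    then have "sqrt (K x x) \<le> C" "sqrt (K (sum_list xs) (sum_list xs)) \<le> C * real (length xs)"
      by (auto simp: word_over_def intro!: gen)
    then show ?case
      using sqrt_kernel_add[of x "sum_list xs"] by (simp add: algebra_simps)
  qed (simp add: kernel_zero)
  have "sqrt (K g g) \<le> C * real (word_length S g)" for g
    using word_length_witness[OF S(2), of g] word by metis
  with \<open>C > 0\<close> show thesis by (rule that)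
qed

section \<open>Choosing the scales\<close>

text \<open>Sublinearity with \<open>\<epsilon> = (1 / 2) ^ n\<close> holds off some compact set, on which the continuous norm of
  the cocycle is bounded; above this bound, which becomes the scale \<open>T n\<close>, the estimate for \<open>f\<close> is
  in terms of the cocycle alone. The lower bound on \<open>T n\<close> ensures that the scales are unbounded.\<close>

lemma (in affine_kernel) scales_for_sublinear:
  assumes lin: "growth_le (\<lambda>g. real (word_length S g)) (\<lambda>g. sqrt (K g g))"
    and f: "\<And>g. f g \<ge> 0" "sublinear_growth S f"
  obtains T M Q where "\<And>n. T n \<ge> real (Suc n)" "M > 0" "compact Q"
    "\<And>g. g \<notin> Q \<Longrightarrow> (f g)\<^sup>2 \<le> M * K g g"
    "\<And>g n. g \<notin> Q \<Longrightarrow> K g g > T n \<Longrightarrow> (f g)\<^sup>2 \<le> (1 / 4) ^ n * M * K g g"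
proof -
  obtain M Q\<^sub>0 where M: "M > 0" and Q\<^sub>0: "compact Q\<^sub>0"
    and le: "\<And>g. g \<notin> Q\<^sub>0 \<Longrightarrow> real (word_length S g) \<le> M * sqrt (K g g)"
    using lin by (auto simp: growth_le_def)
  have sq: "(f g)\<^sup>2 \<le> e\<^sup>2 * M\<^sup>2 * K g g"
    if "g \<notin> Q\<^sub>0" "f g \<le> e * real (word_length S g)" "e > 0" for g e
  proof -
    have "f g \<le> e * (M * sqrt (K g g))"
      using that le[of g] by (meson less_imp_le mult_left_mono order_trans)
    then have "(f g)\<^sup>2 \<le> (e * (M * sqrt (K g g)))\<^sup>2"
      using f(1)[of g] by (rule power_mono)
    then show ?thesis using kernel_nonneg[of g] by (simp add: power_mult_distrib)
  qed
  have ex: "\<exists>Q. compact Q \<and> (\<forall>g. g \<notin> Q \<longrightarrow> f g \<le> e * real (word_length S g))" if "e > 0" for e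
    using f(2) that by (auto simp: sublinear_growth_def growth_less_def)
  obtain Q\<^sub>1 where Q\<^sub>1: "compact Q\<^sub>1" "\<And>g. g \<notin> Q\<^sub>1 \<Longrightarrow> f g \<le> 1 * real (word_length S g)"
    using ex[of 1] by auto
  have "\<exists>t \<ge> real (Suc n). \<forall>g. g \<notin> Q\<^sub>0 \<longrightarrow> K g g > t \<longrightarrow> (f g)\<^sup>2 \<le> (1 / 4) ^ n * M\<^sup>2 * K g g" for n
  proof -
    obtain Q where Q: "compact Q" "\<And>g. g \<notin> Q \<Longrightarrow> f g \<le> (1 / 2) ^ n * real (word_length S g)"
      using ex[of "(1 / 2) ^ n"] by auto
    obtain R where R: "\<And>g. g \<in> Q \<Longrightarrow> K g g \<le> R"
      using compact_continuous_bounded[OF _ Q(1), of "\<lambda>g. K g g"] cocycle_kernel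
      unfolding cocycle_kernel_def by blast
    have "(f g)\<^sup>2 \<le> (1 / 4) ^ n * M\<^sup>2 * K g g" if "g \<notin> Q\<^sub>0" "K g g > max R (real (Suc n))" for g
    proof -
      have "g \<notin> Q" using R[of g] that(2) by auto
      then have "(f g)\<^sup>2 \<le> ((1 / 2) ^ n)\<^sup>2 * M\<^sup>2 * K g g" using sq[OF that(1) Q(2)] by simp
      moreover have "((1 / 2 :: real) ^ n)\<^sup>2 = (1 / 4) ^ n"
        by (simp add: power2_eq_square flip: power_mult_distrib)
      ultimately show ?thesis by simp
    qed
    then show ?thesis by (intro exI[of _ "max R (real (Suc n))"]) auto
  qed
  then obtain T where T: "\<And>n. T n \<ge> real (Suc n)"
    "\<And>n g. g \<notin> Q\<^sub>0 \<Longrightarrow> K g g > T n \<Longrightarrow> (f g)\<^sup>2 \<le> (1 / 4) ^ n * M\<^sup>2 * K g g"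
    by metis
  show thesis
  proof (rule that[of T "M\<^sup>2" "Q\<^sub>0 \<union> Q\<^sub>1"])
    show "compact (Q\<^sub>0 \<union> Q\<^sub>1)" using Q\<^sub>0 Q\<^sub>1(1) by (rule compact_Un)
    fix g assume "g \<notin> Q\<^sub>0 \<union> Q\<^sub>1"
    then show "(f g)\<^sup>2 \<le> M\<^sup>2 * K g g" using sq[of g 1] Q\<^sub>1(2)[of g] by simp
  qed (use T M in auto)
qed

text \<open>For the least \<open>n\<close> with \<open>s \<le> T n\<close>, the function is at least \<open>(1 / 2) ^ n * s / 2\<close>, whereas the
  preceding scale has been passed, so \<open>y\<close> is at most \<open>4 * (1 / 4) ^ n * M * s\<close>; if \<open>n = 0\<close>,
  there is no preceding scale and the bound \<open>M * s\<close> takes its place.\<close>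

lemma (in weighted_scales) le_bernstein:
  assumes T: "\<And>n. T n \<ge> real (Suc n)" and "0 \<le> s" "M > 0"
    and "y \<le> M * s" "\<And>n. s > T n \<Longrightarrow> y \<le> (1 / 4) ^ n * M * s"
  shows "y \<le> 4 * M * bernstein s"
proof -
  define n where "n = (LEAST n. s \<le> T n)"
  obtain k where "s \<le> real k" using real_arch_simple by blast
  then have "s \<le> T k" using T[of k] by simp
  then have n: "s \<le> T n" unfolding n_def by (rule LeastI)
  from bernstein_ge[OF \<open>0 \<le> s\<close> n] have F: "(1 / 2) ^ n * (s / 2) \<le> bernstein s" .
  show ?thesis
  proof (cases n)
    case 0
    then have "M * s \<le> M * (2 * bernstein s)"
      using F \<open>M > 0\<close> by (intro mult_left_mono) auto
    also have "\<dots> \<le> 4 * M * bernstein s"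
      using bernstein_nonneg[OF \<open>0 \<le> s\<close>] \<open>M > 0\<close> by simp
    finally show ?thesis using assms(4) by simp
  next
    case (Suc m)
    then have "s > T m" using not_less_Least[of m "\<lambda>n. s \<le> T n"] by (auto simp: n_def not_le)
    then have "y \<le> (1 / 4) ^ m * M * s" by (rule assms(5))
    also have "\<dots> \<le> (1 / 2) ^ m * M * s"
      using \<open>M > 0\<close> \<open>0 \<le> s\<close> by (intro mult_right_mono power_mono) auto
    also have "\<dots> = 4 * M * ((1 / 2) ^ n * (s / 2))" by (simp add: Suc)
    also have "\<dots> \<le> 4 * M * bernstein s"
      using F \<open>M > 0\<close> by (intro mult_left_mono) auto
    finally show ?thesis .
  qed
qed

text \<open>With \<open>F\<close> the Bernstein function of the scales for \<open>f\<close>, the squared norm of the new cocycle is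
  \<open>F (K g g)\<close>. It dominates \<open>f\<^sup>2\<close> up to a constant by the choice of scales. It is small compared
  with the squared word length because \<open>K g g\<close> is at most quadratic in word length,
  \<open>F s \<le> D + \<epsilon>' * s\<close> for every \<open>\<epsilon>' > 0\<close> and some \<open>D\<close>, and the constant \<open>D\<close> is absorbed off a word ball.\<close>

theorem (in affine_kernel) sublinear_cocycle_above:
  fixes f :: "'g \<Rightarrow> real"
  assumes S: "compact (closure S)" "generates_group S"
    and lin: "growth_le (\<lambda>g. real (word_length S g)) (\<lambda>g. sqrt (K g g))"
    and f: "\<And>g. f g \<ge> 0" "sublinear_growth S f"
  shows "\<exists>(H :: (real, 'g \<Rightarrow> real) inner_module) \<pi> b. orthogonal_cocycle H \<pi> b \<and>
    sublinear_cocycle S H b \<and> growth_le f (\<lambda>g. vnorm H (b g))"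
proof -
  obtain T M Q where T: "\<And>n. T n \<ge> real (Suc n)" and M: "M > 0" and Q: "compact Q"
    and bound: "\<And>g. g \<notin> Q \<Longrightarrow> (f g)\<^sup>2 \<le> M * K g g"
      "\<And>g n. g \<notin> Q \<Longrightarrow> K g g > T n \<Longrightarrow> (f g)\<^sup>2 \<le> (1 / 4) ^ n * M * K g g"
    using scales_for_sublinear[OF lin f] by metis
  interpret T: weighted_scales T
  proof
    show "T n > 0" for n using T[of n] by simp
  qed
  define L where
    "L = (\<lambda>g h. (T.bernstein (K g g) + T.bernstein (K h h) - T.bernstein (K (- g + h) (- g + h))) / 2)"
  interpret L: affine_kernel L
    unfolding L_def
    by unfold_locales (rule cocycle_kernel_bernstein[OF affine_kernel_axioms T.weighted_scales_axioms])
  have vnorm: "vnorm L.rkhs (L.cocycle g) = sqrt (T.bernstein (K g g))" for g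
    by (simp add: L.vnorm_cocycle) (simp add: L_def kernel_zero)
  have "growth_le f (\<lambda>g. vnorm L.rkhs (L.cocycle g))"
    unfolding growth_le_def
  proof (intro exI conjI allI impI)
    show "2 * sqrt M > 0" using M by simp
    show "compact Q" by fact
    fix g assume g: "g \<notin> Q"
    have "(f g)\<^sup>2 \<le> 4 * M * T.bernstein (K g g)"
      using bound[OF g] by (intro T.le_bernstein[OF T kernel_nonneg M])
    then have "f g \<le> sqrt (4 * M * T.bernstein (K g g))" by (rule real_le_rsqrt)
    then show "f g \<le> 2 * sqrt M * vnorm L.rkhs (L.cocycle g)"
      by (simp add: vnorm real_sqrt_mult)
  qed
  moreover have "sublinear_cocycle S L.rkhs L.cocycle"
    unfolding sublinear_cocycle_def sublinear_growth_def growth_less_def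
  proof (intro allI impI)
    fix \<epsilon> :: real assume \<epsilon>: "\<epsilon> > 0"
    obtain C where C: "C > 0" "\<And>g. sqrt (K g g) \<le> C * real (word_length S g)"
      using sqrt_kernel_le_word_length[OF S] by metis
    \<comment> \<open>Half of \<open>\<epsilon>\<^sup>2\<close> is left to absorb the constant \<open>D\<close>.\<close>
    obtain D where D: "\<And>s. 0 \<le> s \<Longrightarrow> T.bernstein s \<le> D + (\<epsilon>\<^sup>2 / (2 * C\<^sup>2)) * s"
      using T.bernstein_sublinear[of "\<epsilon>\<^sup>2 / (2 * C\<^sup>2)"] \<epsilon> C(1) by auto
    obtain P where P: "compact P"
      "\<And>g. g \<notin> P \<Longrightarrow> sqrt (2 * \<bar>D\<bar>) / \<epsilon> < real (word_length S g)"
      using word_balls_relatively_compact[OF S] by metis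
    have "vnorm L.rkhs (L.cocycle g) \<le> \<epsilon> * real (word_length S g)" if "g \<notin> P" for g
    proof -
      define w where "w = real (word_length S g)"
      have w: "sqrt (2 * \<bar>D\<bar>) \<le> \<epsilon> * w"
        using P(2)[OF that] \<epsilon> by (simp add: w_def field_simps)
      have "(sqrt (2 * \<bar>D\<bar>))\<^sup>2 \<le> (\<epsilon> * w)\<^sup>2" using w by (intro power_mono) auto
      then have D2: "D \<le> \<epsilon>\<^sup>2 * w\<^sup>2 / 2" by (simp add: power_mult_distrib)
      have "(sqrt (K g g))\<^sup>2 \<le> (C * w)\<^sup>2"
        using C(2)[of g] kernel_nonneg[of g] unfolding w_def by (intro power_mono) auto
      then have "K g g \<le> C\<^sup>2 * w\<^sup>2" using kernel_nonneg[of g] by (simp add: power_mult_distrib)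
      then have "(\<epsilon>\<^sup>2 / (2 * C\<^sup>2)) * K g g \<le> (\<epsilon>\<^sup>2 / (2 * C\<^sup>2)) * (C\<^sup>2 * w\<^sup>2)"
        by (intro mult_left_mono) auto
      also have "\<dots> = \<epsilon>\<^sup>2 * w\<^sup>2 / 2" using C(1) by simp
      finally have "T.bernstein (K g g) \<le> (\<epsilon> * w)\<^sup>2"
        using D[OF kernel_nonneg[of g]] D2 by (simp add: power_mult_distrib)
      then have "sqrt (T.bernstein (K g g)) \<le> \<epsilon> * w"
        using \<epsilon> by (intro real_le_lsqrt) (auto simp: w_def T.bernstein_nonneg kernel_nonneg)
      then show ?thesis by (simp add: vnorm w_def)
    qed
    with P(1) show "\<exists>Q. compact Q \<and> (\<forall>g. g \<notin> Q \<longrightarrow>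
        vnorm L.rkhs (L.cocycle g) \<le> \<epsilon> * real (word_length S g))" by blast
  qed
  ultimately show ?thesis using L.orthogonal_cocycle_rkhs by blast
qed

lemma (in inner_product_space) growth_kernel_of_cocycle:
  assumes coc: "one_cocycle H \<pi> b" and lin: "linear_cocycle_growth S H b"
  shows "affine_kernel (\<lambda>g h. rip (b g) (b h))"
    and "growth_le (\<lambda>g. real (word_length S g)) (\<lambda>g. sqrt (rip (b g) (b g)))"
proof -
  show "affine_kernel (\<lambda>g h. rip (b g) (b h))"
    using cocycle_kernel_of_cocycle(1)[OF coc] by (rule affine_kernel.intro)
  show "growth_le (\<lambda>g. real (word_length S g)) (\<lambda>g. sqrt (rip (b g) (b g)))"
    using lin unfolding linear_cocycle_growth_def cocycle_kernel_of_cocycle(2)[OF coc]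
    by (simp only: real_sqrt_abs abs_of_nonneg[OF vnorm_nonneg])
qed

text \<open>Real parts of inner products of the values of a real or complex cocycle form a real kernel, so
  the new cocycle can be taken orthogonal in both cases.\<close>

theorem proposition3p13:
  fixes S :: "'g::{topological_group_add, t2_space} set"
    and f :: "'g \<Rightarrow> real"
  assumes "locally_compact_space (euclidean :: 'g topology)"
    and "compact (closure S)" and "generates_group S"
    and "(\<exists>(H :: (real, 'v) inner_module) (\<pi> :: 'g \<Rightarrow> 'v \<Rightarrow> 'v) b.
            orthogonal_cocycle H \<pi> b \<and> linear_cocycle_growth S H b) \<or>
         (\<exists>(H :: (complex, 'w) inner_module) (\<pi> :: 'g \<Rightarrow> 'w \<Rightarrow> 'w) b.
            unitary_cocycle H \<pi> b \<and> linear_cocycle_growth S H b)"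
    and "\<forall>g. f g \<ge> 0" and "sublinear_growth S f"
  shows "(\<exists>(H :: (real, 'g \<Rightarrow> real) inner_module) (\<pi> :: 'g \<Rightarrow> ('g \<Rightarrow> real) \<Rightarrow> ('g \<Rightarrow> real)) b.
            orthogonal_cocycle H \<pi> b \<and> sublinear_cocycle S H b \<and>
            growth_le f (\<lambda>g. vnorm H (b g))) \<or>
         (\<exists>(H :: (complex, 'g \<Rightarrow> complex) inner_module)
            (\<pi> :: 'g \<Rightarrow> ('g \<Rightarrow> complex) \<Rightarrow> ('g \<Rightarrow> complex)) b.
            unitary_cocycle H \<pi> b \<and> sublinear_cocycle S H b \<and>
            growth_le f (\<lambda>g. vnorm H (b g)))"
proof -
  have "\<exists>K :: 'g \<Rightarrow> 'g \<Rightarrow> real. affine_kernel K \<and>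
      growth_le (\<lambda>g. real (word_length S g)) (\<lambda>g. sqrt (K g g))"
    using assms(4)
  proof (elim disjE exE conjE)
    fix H :: "(real, 'v) inner_module" and \<pi> and b :: "'g \<Rightarrow> 'v"
    assume "orthogonal_cocycle H \<pi> b" and lin: "linear_cocycle_growth S H b"
    then have H: "hilbert_space id H" and coc: "one_cocycle H \<pi> b"
      by (auto simp: orthogonal_cocycle_def)
    interpret inner_product_space id id H by (rule inner_product_space_real[OF H])
    show ?thesis using growth_kernel_of_cocycle[OF coc lin] by blast
  next
    fix H :: "(complex, 'w) inner_module" and \<pi> and b :: "'g \<Rightarrow> 'w"
    assume "unitary_cocycle H \<pi> b" and lin: "linear_cocycle_growth S H b"
    then have H: "hilbert_space cnj H" and coc: "one_cocycle H \<pi> b"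
      by (auto simp: unitary_cocycle_def)
    interpret inner_product_space cnj Re H by (rule inner_product_space_complex[OF H])
    show ?thesis using growth_kernel_of_cocycle[OF coc lin] by blast
  qed
  then obtain K :: "'g \<Rightarrow> 'g \<Rightarrow> real" where K: "affine_kernel K"
    "growth_le (\<lambda>g. real (word_length S g)) (\<lambda>g. sqrt (K g g))" by blast
  show ?thesis
    using affine_kernel.sublinear_cocycle_above[OF K(1) assms(2,3) K(2) _ assms(6)] assms(5)
    by blast
qed

end
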